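(* Let $k$ be an $F$-finite field of characteristic $p>0$ and let $a\ge 3$ be an integer. Let $Q$ be the quiver with three vertices $1,2,3$, all mutable, with exactly $a$ arrows $1\to2$, $a$ arrows $2\to 3$, $a$ arrows $3\to1$, and no other arrows, and let $\mathbf x=\{x_1,x_2,x_3\}$ be a cluster in $\mathcal F=k(x_1,x_2,x_3)$ with $x_i$ at vertex $i$. Then the upper cluster algebra $\mathcal U=\mathcal U(Q,\mathbf x)$ is not strongly $F$-regular.
   Context: Cluster algebras. Let $k$ be a field and $\mathcal F$ a purely transcendental extension of $k$ of finite transcendence degree $n$. A seed $(Q,\mathbf x)$ for $\mathcal F$ over $k$ consists of: a finite quiver $Q$ with vertices $1,\dots,n$, without loops or directed 2-cycles (multiple arrows allowed); a cluster $\mathbf x=\{x_1,\dots,x_n\}$ of algebraically independent elements with $\mathcal F=k(x_1,\dots,x_n)$, where $x_i$ is the cluster variable at vertex $i$; and a subset of vertices designated frozen, the other vertices being mutable, with the convention that every vertex touching no arrow is frozen. Mutation of the seed at a mutable vertex $\ell$ gives a new seed: the quiver is changed by (1) adding an arrow $i\to j$ for each pair of arrows $i\to \ell\to j$, (2) reversing all arrows incident to $\ell$, (3) cancelling directed 2-cycles in pairs; all cluster variables stay the same except $x_\ell$, which is replaced by $x_\ell'=\big(\prod_{i\to \ell}x_i+\prod_{\ell\to i}x_i\big)x_\ell^{-1}$ (products over all arrows into, resp. out of, $\ell$); frozen vertices stay frozen. Seeds are mutation-equivalent if related by a sequence of mutations. The upper cluster algebra $\mathcal U(Q,\mathbf x)$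 is the intersection in $\mathcal F$ of the Laurent rings $k[y_1^{\pm1},\dots,y_n^{\pm1}]$ over all clusters $\mathbf y=\{y_1,\dots,y_n\}$ of seeds mutation-equivalent to $(Q,\mathbf x)$. Frobenius notions. For a domain $R$ of characteristic $p>0$, $R^{1/p^e}\supseteq R$ is the ring of $p^e$-th roots of elements of $R$ in an algebraic closure of the fraction field of $R$. $R$ is $F$-finite if $R^{1/p}$ is a finitely generated $R$-module. An $F$-finite domain $R$ is strongly $F$-regular if for every nonzero $x\in R$ there exist $e\in\mathbb N$ and $\psi\in \operatorname{Hom}_R(R^{1/p^e},R)$ with $\psi(x^{1/p^e})=1$. *)

theory Defs
  imports
    "HOL-Algebra.Algebraic_Closure_Type"
    "HOL-Algebra.Generated_Rings"
    "HOL-Algebra.Generated_Fields"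
    "HOL-Library.Poly_Mapping"
    "HOL-Library.Numeral_Type"
begin

section \<open>Cluster algebras\<close>

text \<open>
  The ambient field $\mathcal F$ is a type \<open>'f\<close> of class \<open>field\<close>, and the base field $k$ is a
  subfield \<open>K\<close> of it. The vertices of a quiver are the elements of a finite type \<open>'v\<close>, so that
  $n$ is \<open>CARD('v)\<close>. A quiver is its arrow count: \<open>Q i j\<close> is the number of arrows $i \to j$.
\<close>

type_synonym 'v quiver = "'v \<Rightarrow> 'v \<Rightarrow> nat"

definition valid_quiver :: "'v quiver \<Rightarrow> bool" where
  "valid_quiver Q \<longleftrightarrow> (\<forall>i. Q i i = 0) \<and> (\<forall>i j. Q i j = 0 \<or> Q j i = 0)"

definition add_composites :: "'v \<Rightarrow> 'v quiver \<Rightarrow> 'v quiver" where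
  "add_composites l Q = (\<lambda>i j. Q i j + Q i l * Q l j)"

definition reverse_at :: "'v \<Rightarrow> 'v quiver \<Rightarrow> 'v quiver" where
  "reverse_at l Q = (\<lambda>i j. if i = l \<or> j = l then Q j i else Q i j)"

text \<open>The subtraction is truncated: exactly the pairs of opposite arrows disappear.\<close>

definition cancel_2_cycles :: "'v quiver \<Rightarrow> 'v quiver" where
  "cancel_2_cycles Q = (\<lambda>i j. Q i j - Q j i)"

definition mutate_quiver :: "'v \<Rightarrow> 'v quiver \<Rightarrow> 'v quiver" where
  "mutate_quiver l Q = cancel_2_cycles (reverse_at l (add_composites l Q))"

definition mpoly_eval :: "('v::finite \<Rightarrow> 'f::field) \<Rightarrow> (('v \<Rightarrow>\<^sub>0 nat) \<Rightarrow>\<^sub>0 'f) \<Rightarrow> 'f" where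
  "mpoly_eval x P =
     (\<Sum>m\<in>Poly_Mapping.keys P.
        Poly_Mapping.lookup P m * (\<Prod>i\<in>UNIV. x i ^ Poly_Mapping.lookup m i))"

definition alg_independent :: "'f::field set \<Rightarrow> ('v::finite \<Rightarrow> 'f) \<Rightarrow> bool" where
  "alg_independent K x \<longleftrightarrow>
     (\<forall>P. (\<forall>m. Poly_Mapping.lookup P m \<in> K) \<longrightarrow> mpoly_eval x P = 0 \<longrightarrow> P = 0)"

text \<open>A cluster is indexed by the vertices: \<open>x i\<close> is the cluster variable at vertex \<open>i\<close>.\<close>

definition is_cluster :: "'f::field set \<Rightarrow> ('v::finite \<Rightarrow> 'f) \<Rightarrow> bool" where
  "is_cluster K x \<longleftrightarrow>
     alg_independent K x \<and> generate_field ring_of_type_algebra (K \<union> range x) = UNIV"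

record ('v, 'f) seed =
  quiver :: "'v quiver"
  cluster :: "'v \<Rightarrow> 'f"
  frozen :: "'v set"

definition is_seed :: "'f::field set \<Rightarrow> ('v::finite, 'f) seed \<Rightarrow> bool" where
  "is_seed K S \<longleftrightarrow>
     valid_quiver (quiver S) \<and> is_cluster K (cluster S) \<and>
     (\<forall>i. (\<forall>j. quiver S i j = 0 \<and> quiver S j i = 0) \<longrightarrow> i \<in> frozen S)"

definition mutate_var :: "'v::finite \<Rightarrow> ('v, 'f::field) seed \<Rightarrow> 'f" where
  "mutate_var l S =
     ((\<Prod>i\<in>UNIV. cluster S i ^ quiver S i l) + (\<Prod>i\<in>UNIV. cluster S i ^ quiver S l i))
       / cluster S l"

definition mutate_seed :: "'v::finite \<Rightarrow> ('v, 'f::field) seed \<Rightarrow> ('v, 'f) seed" where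
  "mutate_seed l S =
     \<lparr> quiver = mutate_quiver l (quiver S),
       cluster = (cluster S)(l := mutate_var l S),
       frozen = frozen S \<rparr>"

inductive mutation_equivalent ::
  "('v::finite, 'f::field) seed \<Rightarrow> ('v, 'f) seed \<Rightarrow> bool" for S where
  refl: "mutation_equivalent S S"
| mutate: "mutation_equivalent S T \<Longrightarrow> l \<notin> frozen T \<Longrightarrow> mutation_equivalent S (mutate_seed l T)"

definition laurent_ring :: "'f::field set \<Rightarrow> ('v::finite \<Rightarrow> 'f) \<Rightarrow> 'f set" where
  "laurent_ring K y =
     generate_ring ring_of_type_algebra (K \<union> range y \<union> range (\<lambda>i. inverse (y i)))"

definition upper_cluster_algebra :: "'f::field set \<Rightarrow> ('v::finite, 'f) seed \<Rightarrow> 'f set" where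
  "upper_cluster_algebra K S =
     (\<Inter>T\<in>{T. mutation_equivalent S T}. laurent_ring K (cluster T))"

definition cyclic_quiver :: "nat \<Rightarrow> 3 quiver" where
  "cyclic_quiver a = (\<lambda>i j. if (i, j) \<in> {(1, 2), (2, 3), (3, 1)} then a else 0)"

definition cyclic_seed :: "nat \<Rightarrow> (3 \<Rightarrow> 'f) \<Rightarrow> (3, 'f) seed" where
  "cyclic_seed a x = \<lparr> quiver = cyclic_quiver a, cluster = x, frozen = {} \<rparr>"

lemma type_3_cases: "(i::3) = 1 \<or> i = 2 \<or> i = 3"
proof -
  have "i \<in> {1, 2, 3}"
  proof -
    have "{1, 2, 3::3} = UNIV"
      by (rule card_subset_eq) simp_all
    thus ?thesis by simp
  qed
  thus ?thesis by simp
qed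

lemma is_seed_cyclic_seed:
  assumes "a > 0" and "is_cluster K x"
  shows "is_seed K (cyclic_seed a x)"
proof -
  have "\<exists>j. cyclic_quiver a i j \<noteq> 0" for i :: 3
    using type_3_cases[of i] assms(1) by (auto simp: cyclic_quiver_def)
  moreover have "valid_quiver (cyclic_quiver a)"
    by (auto simp: valid_quiver_def cyclic_quiver_def)
  ultimately show ?thesis
    using assms(2) by (fastforce simp: is_seed_def cyclic_seed_def)
qed

section \<open>Frobenius notions\<close>

text \<open>
  Here \<open>R\<close> is a subring of a field \<open>'f\<close> of characteristic $p > 0$. The algebraic closure of the
  fraction field of \<open>R\<close> sits inside \<open>'f alg_closure\<close> and contains all $p^e$-th roots of elements
  of \<open>R\<close>, so \<open>frobenius_roots e R\<close> is $R^{1/p^e}$; the copy of \<open>R\<close> in it is the image of \<open>to_ac\<close>.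
\<close>

definition frobenius_roots :: "nat \<Rightarrow> 'f::field set \<Rightarrow> 'f alg_closure set" where
  "frobenius_roots e R = {y. y ^ (CHAR('f) ^ e) \<in> to_ac ` R}"

definition F_finite :: "'f::field set \<Rightarrow> bool" where
  "F_finite R \<longleftrightarrow>
     (\<exists>B. finite B \<and> B \<subseteq> frobenius_roots 1 R \<and>
       (\<forall>y\<in>frobenius_roots 1 R. \<exists>c. (\<forall>b\<in>B. c b \<in> R) \<and> y = (\<Sum>b\<in>B. to_ac (c b) * b)))"

definition frobenius_hom :: "nat \<Rightarrow> 'f::field set \<Rightarrow> ('f alg_closure \<Rightarrow> 'f) \<Rightarrow> bool" where
  "frobenius_hom e R \<psi> \<longleftrightarrow>
     (\<forall>y\<in>frobenius_roots e R. \<psi> y \<in> R) \<and>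
     (\<forall>y\<in>frobenius_roots e R. \<forall>z\<in>frobenius_roots e R. \<psi> (y + z) = \<psi> y + \<psi> z) \<and>
     (\<forall>r\<in>R. \<forall>y\<in>frobenius_roots e R. \<psi> (to_ac r * y) = r * \<psi> y)"

text \<open>
  The notion is meant for F-finite domains. F-finiteness is deliberately not a conjunct, so that a
  ring cannot fail to be strongly F-regular for the sole reason that it is not F-finite.
  The element \<open>y\<close> is the unique $p^e$-th root of \<open>x\<close>.
\<close>

definition strongly_F_regular :: "'f::field set \<Rightarrow> bool" where
  "strongly_F_regular R \<longleftrightarrow>
     (\<forall>x\<in>R. x \<noteq> 0 \<longrightarrow>
       (\<exists>e \<psi>. frobenius_hom e R \<psi> \<and> (\<exists>y. y ^ (CHAR('f) ^ e) = to_ac x \<and> \<psi> y = 1)))"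

end

theory Submission
  imports Defs "HOL-Library.Function_Algebras"
begin

text \<open>
  Suppose that $\psi$ sends $(x_1 x_2 x_3)^{1/q}$ to $1$. On monomials $\psi$ is the standard
  splitting $\varphi$ premultiplied by some $h^{1/q}$. Since $\varphi$ is the same map for
  all clusters, $h$ is an element of the upper cluster algebra $\mathcal U$, and
  $\psi((x_1 x_2 x_3)^{1/q}) = 1$ forces $h$ to contain the monomial $(x_1 x_2 x_3)^{-1}$.
  But for $a \ge 3$ the algebra $\mathcal U$, graded by $\deg x_i = 1$, has no elements of negative
  degree: membership in the Laurent ring of a neighbouring cluster makes the coefficient of
  $x_i^{-k}$ divisible by the $k$-th power of the exchange binomial, and in negative degree there
  is no room for this in all three directions.

  That $h$ can be tested on monomials requires $\mathcal U$ to contain the initial cluster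
  variables and their mutations; for this the upper bound of a seed, i.e. the intersection of its
  Laurent ring with those of its neighbours, is shown to be invariant under mutation.
\<close>

section \<open>Laurent rings inside a field\<close>

text \<open>That \<open>h\<close> does not depend on the cluster reflects a geometric fact: mutation
  preserves the logarithmic volume form of the torus up to sign, and over a perfect field the
  monomial splitting is the Cartier operator of that form. Here it is proved as an identity of
  finite sums, in which \<open>\<theta>\<close> is evaluated only at monomials with exponents in
  \<open>{1..q}\<close>. These lie in the algebra, so the given map never has to be extended to a
  Laurent ring. The degree argument is sharp in \<open>a\<close>: for a = 2 the element (x_1^2 +
  x_2^2 + x_3^2) / (x_1 x_2 x_3) lies in the Laurent rings of the initial cluster and of its three
  neighbours, and has degree -1. Mutation does not reproduce the initial quiver, since the numbers
  of arrows change from seed to seed. Invariance of the upper bound is therefore proved for a whole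
  family of weighted 3-cycles, whose weights record the degrees of the cluster variables.\<close>

locale subring_set =
  fixes L :: "'f::field set"
  assumes one_closed: "1 \<in> L"
    and uminus_closed: "f \<in> L \<Longrightarrow> - f \<in> L"
    and add_closed: "f \<in> L \<Longrightarrow> g \<in> L \<Longrightarrow> f + g \<in> L"
    and mult_closed: "f \<in> L \<Longrightarrow> g \<in> L \<Longrightarrow> f * g \<in> L"
begin

lemma zero_closed: "0 \<in> L"
  using add_closed[OF one_closed uminus_closed[OF one_closed]] by simp

lemma diff_closed: "f \<in> L \<Longrightarrow> g \<in> L \<Longrightarrow> f - g \<in> L"
  using add_closed[of f "- g"] uminus_closed[of g] by simp

lemma power_closed: "f \<in> L \<Longrightarrow> f ^ n \<in> L"
  by (induction n) (auto intro: one_closed mult_closed)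

lemma sum_closed: "(\<And>i. i \<in> A \<Longrightarrow> f i \<in> L) \<Longrightarrow> sum f A \<in> L"
  by (induction A rule: infinite_finite_induct) (auto intro: zero_closed add_closed)

lemma prod_closed: "(\<And>i. i \<in> A \<Longrightarrow> f i \<in> L) \<Longrightarrow> prod f A \<in> L"
  by (induction A rule: infinite_finite_induct) (auto intro: one_closed mult_closed)

lemmas closed = zero_closed one_closed uminus_closed add_closed mult_closed diff_closed
  power_closed sum_closed prod_closed

end

lemma subring_set_Inter: "(\<And>L. L \<in> A \<Longrightarrow> subring_set L) \<Longrightarrow> subring_set (\<Inter> A)"
  unfolding subring_set_def by blast

lemma a_inv_ring_of_type_algebra: "\<ominus>\<^bsub>ring_of_type_algebra\<^esub> (f :: 'f::field) = - f"
proof -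
  interpret R: field "ring_of_type_algebra :: 'f ring"
    by (rule field_from_type_algebra)
  show ?thesis
    by (rule R.minus_equality) (auto simp: ring_of_type_algebra_def)
qed

lemma subfield_subring_set:
  assumes "subfield K ring_of_type_algebra"
  shows "subring_set (K :: 'f::field set)"
proof -
  have "subring K ring_of_type_algebra"
    using assms by (intro subcring.axioms(1) subdomain.axioms(1) subfield.axioms(1))
  note * = subringE[OF this]
  show ?thesis
    using *(3,5,6,7)
    by unfold_locales
      (simp_all add: a_inv_ring_of_type_algebra, simp_all add: ring_of_type_algebra_def)
qed

lemma subring_set_laurent_ring: "subring_set (laurent_ring K y)"
  using generate_ring.intros[where R = "ring_of_type_algebra :: 'a::field ring"]
  unfolding laurent_ring_def
  by unfold_locales (simp_all add: a_inv_ring_of_type_algebra, simp_all add: ring_of_type_algebra_def)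

lemma laurent_ring_base: "c \<in> K \<Longrightarrow> c \<in> laurent_ring K y"
  and laurent_ring_var: "y i \<in> laurent_ring K y"
  and laurent_ring_inverse: "inverse (y i) \<in> laurent_ring K y"
  unfolding laurent_ring_def by (auto intro!: generate_ring.incl)

lemma laurent_ring_induct [consumes 1, case_names base var inverse one uminus add mult]:
  assumes "f \<in> laurent_ring K y"
    and "\<And>c. c \<in> K \<Longrightarrow> P c" and "\<And>i. P (y i)" and "\<And>i. P (inverse (y i))"
    and "P 1" and "\<And>f. f \<in> laurent_ring K y \<Longrightarrow> P f \<Longrightarrow> P (- f)"
    and "\<And>f g. P f \<Longrightarrow> P g \<Longrightarrow> P (f + g)" and "\<And>f g. P f \<Longrightarrow> P g \<Longrightarrow> P (f * g)"
  shows "P f"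
  using assms(1) unfolding laurent_ring_def
proof (induction rule: generate_ring.induct)
  case (a_inv f)
  then show ?case
    using assms(6)[of f] by (simp add: a_inv_ring_of_type_algebra laurent_ring_def)
qed (use assms in \<open>auto simp: ring_of_type_algebra_def\<close>)

lemma laurent_ring_subset:
  assumes "subring_set L" "K \<subseteq> L" "\<And>i. y i \<in> L" "\<And>i. inverse (y i) \<in> L"
  shows "laurent_ring K y \<subseteq> L"
proof
  interpret subring_set L by fact
  show "f \<in> L" if "f \<in> laurent_ring K y" for f
    using that by (induction rule: laurent_ring_induct) (use assms in \<open>auto intro: closed\<close>)
qed

text \<open>Meant for \<open>L\<close> the Laurent ring of another cluster, which contains the
  \<open>y i\<close> but perhaps not their inverses. An inverse costs one factor of the product of
  all variables, and the exponents add up under sums and products.\<close>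

lemma laurent_ring_clear_denominators:
  fixes y :: "'v::finite \<Rightarrow> 'f::field"
  assumes "subring_set L" "K \<subseteq> L" and y: "\<And>i. y i \<in> L" and nz: "\<And>i. y i \<noteq> 0"
    and "f \<in> laurent_ring K y"
  shows "\<exists>N. f * (\<Prod>i\<in>UNIV. y i) ^ N \<in> L"
proof -
  interpret subring_set L by fact
  let ?p = "\<Prod>i\<in>UNIV. y i"
  have p: "?p \<in> L" using y by (rule prod_closed)
  from assms(5) show ?thesis
  proof (induction rule: laurent_ring_induct)
    case (base c)
    then show ?case using assms(2) by (auto intro!: exI[of _ 0])
  next
    case (var i)
    show ?case using y[of i] by (auto intro!: exI[of _ 0])
  next
    case (inverse i)
    have "?p = y i * (\<Prod>j\<in>UNIV - {i}. y j)"
      by (rule prod.remove) auto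
    then have "inverse (y i) * ?p ^ 1 = (\<Prod>j\<in>UNIV - {i}. y j)"
      using nz[of i] by simp
    also have "\<dots> \<in> L" by (intro prod_closed y)
    finally show ?case by blast
  next
    case one
    show ?case by (rule exI[of _ 0]) (simp add: one_closed)
  next
    case (uminus f)
    then obtain N where "f * ?p ^ N \<in> L" by blast
    then have "- f * ?p ^ N \<in> L" using uminus_closed by fastforce
    then show ?case by blast
  next
    case (add f g)
    then obtain M N where *: "f * ?p ^ M \<in> L" "g * ?p ^ N \<in> L" by blast
    have "(f + g) * ?p ^ (M + N) = f * ?p ^ M * ?p ^ N + g * ?p ^ N * ?p ^ M"
      by (simp add: algebra_simps power_add)
    also have "\<dots> \<in> L" by (intro add_closed *[THEN mult_closed] power_closed p)
    finally show ?case by blast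
  next
    case (mult f g)
    then obtain M N where *: "f * ?p ^ M \<in> L" "g * ?p ^ N \<in> L" by blast
    have "f * g * ?p ^ (M + N) = (f * ?p ^ M) * (g * ?p ^ N)"
      by (simp add: algebra_simps power_add)
    also have "\<dots> \<in> L" by (rule mult_closed[OF *])
    finally show ?case by blast
  qed
qed

section \<open>Expansions in Laurent monomials\<close>

definition lmonom :: "('v::finite \<Rightarrow> 'f::field) \<Rightarrow> ('v \<Rightarrow> int) \<Rightarrow> 'f" where
  "lmonom y m = (\<Prod>i\<in>UNIV. y i powi m i)"

lemma lmonom_add: "(\<And>i. y i \<noteq> 0) \<Longrightarrow> lmonom y (m + n) = lmonom y m * lmonom y n"
  by (simp add: lmonom_def power_int_add prod.distrib)

lemma lmonom_upd: "lmonom (y(l := u)) m = u powi m l * lmonom (y(l := 1)) m"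
proof -
  have "lmonom (y(l := u)) m = u powi m l * (\<Prod>i\<in>UNIV - {l}. y i powi m i)" for u
    unfolding lmonom_def by (subst prod.remove[of _ l]) auto
  from this[of u] this[of 1] show ?thesis by simp
qed

lemma lmonom_split: "lmonom y m = y l powi m l * lmonom (y(l := 1)) m"
  using lmonom_upd[of y l "y l"] by simp

lemma lmonom_face: "lmonom (y(l := 1)) m = lmonom y (m(l := 0))"
  unfolding lmonom_def by (rule prod.cong) auto

lemma lmonom_single: "lmonom y (0(l := e)) = y l powi e"
proof -
  have "lmonom y (0(l := e)) = y l powi e * (\<Prod>i\<in>UNIV - {l}. y i powi (0(l := e)) i)"
    unfolding lmonom_def by (subst prod.remove[of _ l]) auto
  also have "(\<Prod>i\<in>UNIV - {l}. y i powi (0(l := e)) i) = 1"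
    by (rule prod.neutral) auto
  finally show ?thesis by (simp only: mult_1_right)
qed

lemma lmonom_laurent_ring: "lmonom y m \<in> laurent_ring K y"
proof -
  interpret subring_set "laurent_ring K y" by (rule subring_set_laurent_ring)
  have "y i powi e \<in> laurent_ring K y" for i e
    by (cases "e \<ge> 0")
      (auto simp: power_int_def intro: power_closed laurent_ring_var laurent_ring_inverse)
  then show ?thesis unfolding lmonom_def by (intro prod_closed)
qed

text \<open>Built one term at a time, so that induction has no product case, in which coefficient
  functions would have to be convolved.\<close>

inductive_set laurent_span :: "'f::field set \<Rightarrow> ('v::finite \<Rightarrow> 'f) \<Rightarrow> 'f set" for K y where
  zero: "0 \<in> laurent_span K y"
| add: "c \<in> K \<Longrightarrow> f \<in> laurent_span K y \<Longrightarrow> c * lmonom y m + f \<in> laurent_span K y"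

lemma laurent_span_subset: "laurent_span K y \<subseteq> laurent_ring K y"
proof
  interpret subring_set "laurent_ring K y" by (rule subring_set_laurent_ring)
  show "f \<in> laurent_ring K y" if "f \<in> laurent_span K y" for f
    using that by induction (auto intro: closed laurent_ring_base lmonom_laurent_ring)
qed

lemma laurent_ring_eq_span:
  assumes K: "subring_set K" and nz: "\<And>i. y i \<noteq> 0"
  shows "laurent_ring K y = laurent_span K y"
proof (rule antisym[OF _ laurent_span_subset], rule laurent_ring_subset)
  interpret K: subring_set K by fact
  have mon: "c * lmonom y m \<in> laurent_span K y" if "c \<in> K" for c m
    using laurent_span.add[OF that laurent_span.zero] by simp
  have "f + g \<in> laurent_span K y" if "f \<in> laurent_span K y" "g \<in> laurent_span K y" for f g
    using that by induction (auto intro: laurent_span.add simp: add.assoc)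
  note plus = this
  have smult: "c * lmonom y m * f \<in> laurent_span K y" if "c \<in> K" "f \<in> laurent_span K y" for c m f
    using that(2,1)
  proof (induction)
    case (add d f n)
    have "c * lmonom y m * (d * lmonom y n + f) = (c * d) * lmonom y (m + n) + c * lmonom y m * f"
      by (simp add: lmonom_add[OF nz] algebra_simps)
    with add show ?case by (auto intro!: laurent_span.add K.mult_closed)
  qed (auto intro: laurent_span.zero)
  have mon0: "lmonom y 0 = 1" by (simp add: lmonom_def)
  show "subring_set (laurent_span K y)"
  proof
    show one: "1 \<in> laurent_span K y"
      using mon[of 1 0] K.one_closed by (simp add: mon0)
    show "f + g \<in> laurent_span K y" if "f \<in> laurent_span K y" "g \<in> laurent_span K y" for f g
      using plus that .
    show "- f \<in> laurent_span K y" if "f \<in> laurent_span K y" for f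
      using smult[of "- 1" f 0] that K.one_closed K.uminus_closed by (simp add: mon0)
    show "f * g \<in> laurent_span K y" if "f \<in> laurent_span K y" "g \<in> laurent_span K y" for f g
      using that by induction (auto intro: laurent_span.zero plus smult simp: distrib_right)
  qed
  show "K \<subseteq> laurent_span K y"
    using mon[of _ 0] by (auto simp: mon0)
  show "y i \<in> laurent_span K y" for i
    using mon[OF K.one_closed, of "0(i := 1)"] by (simp add: lmonom_single)
  show "inverse (y i) \<in> laurent_span K y" for i
    using mon[OF K.one_closed, of "0(i := -1)"] by (simp add: lmonom_single)
qed

lemma laurent_ring_mon_induct [consumes 3, case_names zero add]:
  assumes "subring_set K" "\<And>i. y i \<noteq> 0" "f \<in> laurent_ring K y"
    and "P 0"
    and "\<And>c m g. c \<in> K \<Longrightarrow> g \<in> laurent_ring K y \<Longrightarrow> P g \<Longrightarrow> P (c * lmonom y m + g)"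
  shows "P f"
proof -
  have eq: "laurent_ring K y = laurent_span K y"
    using assms(1,2) by (rule laurent_ring_eq_span)
  show ?thesis using assms(3) unfolding eq
    by induction (auto intro: assms(4,5) simp: eq)
qed

text \<open>Setting \<open>y l\<close> to 1 gives the Laurent ring in the remaining variables
  without a change of index type. The expansion is asserted for all large \<open>N\<close>, so that
  two expansions can be brought to a common range.\<close>

lemma laurent_ring_graded:
  assumes "subring_set K" "\<And>i. y i \<noteq> 0" "f \<in> laurent_ring K y"
  shows "\<exists>A N\<^sub>0. (\<forall>e. A e \<in> laurent_ring K (y(l := 1))) \<and>
           (\<forall>N\<ge>N\<^sub>0. f = (\<Sum>e\<in>{-N..N::int}. y l powi e * A e))"
  using assms
proof (induction rule: laurent_ring_mon_induct)
  interpret R: subring_set "laurent_ring K (y(l := 1))" by (rule subring_set_laurent_ring)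
  case zero
  show ?case by (rule exI[of _ "\<lambda>_. 0"]) (use R.zero_closed in \<open>simp del: fun_upd_apply\<close>)
next
  interpret R: subring_set "laurent_ring K (y(l := 1))" by (rule subring_set_laurent_ring)
  case (add c m g)
  then obtain A N\<^sub>0 where A: "\<And>e. A e \<in> laurent_ring K (y(l := 1))"
    and g: "\<And>N. N \<ge> N\<^sub>0 \<Longrightarrow> g = (\<Sum>e\<in>{-N..N::int}. y l powi e * A e)" by blast
  define B where "B e = (if e = m l then c * lmonom (y(l := 1)) m else 0) + A e" for e
  have "c * lmonom (y(l := 1)) m \<in> laurent_ring K (y(l := 1))"
    by (intro R.mult_closed laurent_ring_base[OF add.hyps(1)] lmonom_laurent_ring)
  then have "B e \<in> laurent_ring K (y(l := 1))" for e
    unfolding B_def using A[of e] by (auto intro: R.add_closed simp del: fun_upd_apply)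
  moreover have "c * lmonom y m + g = (\<Sum>e\<in>{-N..N::int}. y l powi e * B e)"
    if "N \<ge> max N\<^sub>0 \<bar>m l\<bar>" for N
  proof -
    have "m l \<in> {-N..N}" using that by auto
    then have "(\<Sum>e\<in>{-N..N}. y l powi e * B e) = y l powi m l * (c * lmonom (y(l := 1)) m)
        + (\<Sum>e\<in>{-N..N}. y l powi e * A e)"
      by (simp add: B_def distrib_left sum.distrib if_distrib[of "(*) _"] cong: if_cong)
    then show ?thesis using g[of N] that by (simp add: lmonom_split[of y m l])
  qed
  ultimately show ?case by blast
qed

text \<open>Linear independence of Laurent monomials replaces algebraic independence of the
  variables: it yields unique coefficients at once, and it passes from a cluster to its mutations by
  a comparison of expansions.\<close>

locale laurent_frame =
  fixes K :: "'f::field set" and y :: "'v::finite \<Rightarrow> 'f"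
  assumes K: "subring_set K"
    and nz: "y i \<noteq> 0"
    and indep: "finite S \<Longrightarrow> (\<And>m. m \<in> S \<Longrightarrow> c m \<in> K) \<Longrightarrow> (\<Sum>m\<in>S. c m * lmonom y m) = 0 \<Longrightarrow>
                  m \<in> S \<Longrightarrow> c m = 0"
begin

sublocale K: subring_set K by (rule K)

abbreviation "L \<equiv> laurent_ring K y"

abbreviation "face l \<equiv> laurent_ring K (y(l := 1))"

sublocale L: subring_set L by (rule subring_set_laurent_ring)

text \<open>The set \<open>S\<close> may exceed the support of \<open>c\<close>. Thus coefficient
  functions can be added over a common set even when terms cancel.\<close>

definition is_lcoeff :: "'f \<Rightarrow> (('v \<Rightarrow> int) \<Rightarrow> 'f) \<Rightarrow> bool" where
  "is_lcoeff f c \<longleftrightarrow> range c \<subseteq> K \<and>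
     (\<exists>S. finite S \<and> {m. c m \<noteq> 0} \<subseteq> S \<and> f = (\<Sum>m\<in>S. c m * lmonom y m))"

definition lcoeff :: "'f \<Rightarrow> ('v \<Rightarrow> int) \<Rightarrow> 'f" where
  "lcoeff f = (SOME c. is_lcoeff f c)"

lemma is_lcoeff_0: "is_lcoeff 0 (\<lambda>_. 0)"
  unfolding is_lcoeff_def by (auto intro: K.zero_closed)

lemma is_lcoeff_mon: "c \<in> K \<Longrightarrow> is_lcoeff (c * lmonom y m) (\<lambda>n. if n = m then c else 0)"
  unfolding is_lcoeff_def by (auto intro!: exI[of _ "{m}"] K.zero_closed)

lemma is_lcoeff_add:
  assumes "is_lcoeff f c" "is_lcoeff g d"
  shows "is_lcoeff (f + g) (\<lambda>m. c m + d m)"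
proof -
  obtain S where S: "finite S" "{m. c m \<noteq> 0} \<subseteq> S" "f = (\<Sum>m\<in>S. c m * lmonom y m)"
    using assms unfolding is_lcoeff_def by blast
  obtain T where T: "finite T" "{m. d m \<noteq> 0} \<subseteq> T" "g = (\<Sum>m\<in>T. d m * lmonom y m)"
    using assms unfolding is_lcoeff_def by blast
  have "f = (\<Sum>m\<in>S \<union> T. c m * lmonom y m)" unfolding S(3)
    by (rule sum.mono_neutral_left) (use S T in auto)
  moreover have "g = (\<Sum>m\<in>S \<union> T. d m * lmonom y m)" unfolding T(3)
    by (rule sum.mono_neutral_left) (use S T in auto)
  ultimately have "f + g = (\<Sum>m\<in>S \<union> T. (c m + d m) * lmonom y m)"
    by (simp add: distrib_right sum.distrib)
  moreover have "{m. c m + d m \<noteq> 0} \<subseteq> {m. c m \<noteq> 0} \<union> {m. d m \<noteq> 0}" by auto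
  then have "{m. c m + d m \<noteq> 0} \<subseteq> S \<union> T" using S(2) T(2) by blast
  ultimately show ?thesis
    using assms S(1) T(1) unfolding is_lcoeff_def
    by (auto intro!: K.add_closed exI[of _ "S \<union> T"])
qed

lemma is_lcoeff_uminus: "is_lcoeff f c \<Longrightarrow> is_lcoeff (- f) (\<lambda>m. - c m)"
  unfolding is_lcoeff_def by (auto simp: sum_negf intro: K.uminus_closed)

lemma is_lcoeff_mult_mon:
  assumes "is_lcoeff f c"
  shows "is_lcoeff (lmonom y n * f) (\<lambda>m. c (m - n))"
proof -
  obtain S where S: "finite S" "{m. c m \<noteq> 0} \<subseteq> S" "f = (\<Sum>m\<in>S. c m * lmonom y m)"
    using assms unfolding is_lcoeff_def by blast
  have "lmonom y n * f = (\<Sum>m\<in>S. c m * lmonom y (m + n))"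
    unfolding S(3) by (simp add: sum_distrib_left lmonom_add[OF nz] mult_ac)
  also have "\<dots> = (\<Sum>m\<in>(\<lambda>m. m + n) ` S. c (m - n) * lmonom y m)"
    by (subst sum.reindex) (auto simp: inj_on_def)
  finally have "lmonom y n * f = (\<Sum>m\<in>(\<lambda>m. m + n) ` S. c (m - n) * lmonom y m)" .
  moreover have "{m. c (m - n) \<noteq> 0} \<subseteq> (\<lambda>m. m + n) ` S"
    using S(2) by (force intro: image_eqI[of _ _ "m - n" for m])
  ultimately show ?thesis
    using assms S(1) unfolding is_lcoeff_def
    by (auto intro!: exI[of _ "(\<lambda>m. m + n) ` S"])
qed

lemma is_lcoeff_unique:
  assumes "is_lcoeff f c" "is_lcoeff f d"
  shows "c = d"
proof
  have "is_lcoeff 0 (\<lambda>m. c m + - d m)"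
    using is_lcoeff_add[OF assms(1) is_lcoeff_uminus[OF assms(2)]] by simp
  then obtain S where S: "finite S" "{m. c m + - d m \<noteq> 0} \<subseteq> S"
      "(\<Sum>m\<in>S. (c m + - d m) * lmonom y m) = 0" and K: "\<And>m. c m + - d m \<in> K"
    unfolding is_lcoeff_def by fastforce
  fix m
  show "c m = d m"
  proof (cases "m \<in> S")
    case True
    from indep[OF S(1) K S(3) True] show ?thesis by simp
  next
    case False
    with S(2) show ?thesis by auto
  qed
qed

lemma is_lcoeff_lcoeff: "f \<in> L \<Longrightarrow> is_lcoeff f (lcoeff f)"
proof -
  assume "f \<in> L"
  with K nz have "\<exists>c. is_lcoeff f c"
  proof (induction rule: laurent_ring_mon_induct)
    case (add c m g)
    then show ?case using is_lcoeff_add is_lcoeff_mon by blast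
  qed (use is_lcoeff_0 in blast)
  then show ?thesis unfolding lcoeff_def by (rule someI_ex)
qed

lemma lcoeff_eqI: "is_lcoeff f c \<Longrightarrow> lcoeff f = c"
  unfolding lcoeff_def using is_lcoeff_unique by blast

lemma lcoeff_0 [simp]: "lcoeff 0 m = 0"
  using lcoeff_eqI[OF is_lcoeff_0] by simp

lemma lcoeff_mon: "c \<in> K \<Longrightarrow> lcoeff (c * lmonom y m) n = (if n = m then c else 0)"
  using lcoeff_eqI[OF is_lcoeff_mon] by metis

lemma lcoeff_add: "f \<in> L \<Longrightarrow> g \<in> L \<Longrightarrow> lcoeff (f + g) m = lcoeff f m + lcoeff g m"
  using lcoeff_eqI[OF is_lcoeff_add[OF is_lcoeff_lcoeff is_lcoeff_lcoeff]] by metis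

lemma lcoeff_sum: "(\<And>i. i \<in> A \<Longrightarrow> f i \<in> L) \<Longrightarrow> lcoeff (sum f A) m = (\<Sum>i\<in>A. lcoeff (f i) m)"
  by (induction A rule: infinite_finite_induct) (auto simp: lcoeff_add L.sum_closed)

lemma lcoeff_mult_mon: "f \<in> L \<Longrightarrow> lcoeff (lmonom y n * f) m = lcoeff f (m - n)"
  using lcoeff_eqI[OF is_lcoeff_mult_mon[OF is_lcoeff_lcoeff]] by metis

lemma finite_lcoeff: "f \<in> L \<Longrightarrow> finite {m. lcoeff f m \<noteq> 0}"
  using is_lcoeff_lcoeff[of f] unfolding is_lcoeff_def by (auto intro: finite_subset)

lemma lcoeff_eq_0D: "f \<in> L \<Longrightarrow> (\<And>m. lcoeff f m = 0) \<Longrightarrow> f = 0"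
  using is_lcoeff_lcoeff[of f] unfolding is_lcoeff_def by auto

lemma face_subset: "face l \<subseteq> L"
  by (rule laurent_ring_subset)
    (auto intro: L.one_closed laurent_ring_base laurent_ring_var laurent_ring_inverse subring_set_laurent_ring)

lemma lcoeff_face:
  assumes "f \<in> face l" "m l \<noteq> 0"
  shows "lcoeff f m = 0"
proof -
  have nz': "(y(l := 1)) i \<noteq> 0" for i using nz by simp
  from K nz' assms(1) show ?thesis
  proof (induction rule: laurent_ring_mon_induct)
    case (add c n g)
    have "c * lmonom y (n(l := 0)) \<in> L"
      using add.hyps by (intro L.mult_closed laurent_ring_base lmonom_laurent_ring)
    moreover have "g \<in> L" using add.hyps face_subset by blast
    ultimately show ?case
      using add assms(2) by (auto simp: lmonom_face lcoeff_add lcoeff_mon)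
  qed simp
qed

lemma lcoeff_graded:
  assumes "finite E" "\<And>e. A e \<in> face l"
  shows "lcoeff (\<Sum>e\<in>E. y l powi e * A e) m = (if m l \<in> E then lcoeff (A (m l)) (m(l := 0)) else 0)"
proof -
  have AL: "A e \<in> L" for e using assms(2) face_subset by blast
  have "lcoeff (\<Sum>e\<in>E. y l powi e * A e) m = (\<Sum>e\<in>E. lcoeff (y l powi e * A e) m)"
    by (intro lcoeff_sum L.mult_closed AL) (metis lmonom_laurent_ring lmonom_single)
  also have "\<dots> = (\<Sum>e\<in>E. if e = m l then lcoeff (A (m l)) (m(l := 0)) else 0)"
  proof (rule sum.cong[OF HOL.refl])
    fix e
    have "lcoeff (y l powi e * A e) m = lcoeff (A e) (m - 0(l := e))"
      unfolding lmonom_single[symmetric] by (rule lcoeff_mult_mon[OF AL])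
    also have "\<dots> = (if e = m l then lcoeff (A (m l)) (m(l := 0)) else 0)"
    proof (cases "e = m l")
      case True
      then have "m - 0(l := e) = m(l := 0)" by (auto simp: fun_eq_iff)
      with True show ?thesis by simp
    next
      case False
      with lcoeff_face[OF assms(2)[of e], of "m - 0(l := e)"] show ?thesis by auto
    qed
    finally show "lcoeff (y l powi e * A e) m = \<dots>" .
  qed
  also have "\<dots> = (if m l \<in> E then lcoeff (A (m l)) (m(l := 0)) else 0)"
    using assms(1) by simp
  finally show ?thesis .
qed

lemma graded_eq_0D:
  assumes "finite E" "\<And>e. A e \<in> face l" "(\<Sum>e\<in>E. y l powi e * A e) = 0" "e \<in> E"
  shows "A e = 0"
proof (rule lcoeff_eq_0D)
  show "A e \<in> L" using assms(2) face_subset by blast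
  show "lcoeff (A e) m = 0" for m
  proof (cases "m l = 0")
    case True
    then have "(m(l := e))(l := 0) = m" by (auto simp: fun_eq_iff)
    then show ?thesis
      using lcoeff_graded[where A = A, OF assms(1,2), where m = "m(l := e)"] assms(3,4) by simp
  qed (use lcoeff_face assms(2) in blast)
qed

text \<open>The exponent of \<open>P\<close> comes from \<open>u powi e = P powi e * y l powi (- e)\<close>.\<close>

lemma graded_mutation:
  assumes A: "\<And>e. A e \<in> face l" and B: "\<And>e. B e \<in> face l"
    and P: "P \<in> face l" "P \<noteq> 0"
    and eq: "(\<Sum>e\<in>{-N..N::int}. y l powi e * A e) = (\<Sum>e\<in>{-N..N}. (P / y l) powi e * B e)"
    and e: "e \<in> {-N..N}"
  shows "A (- e) = P powi e * B e"
proof -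
  interpret R: subring_set "face l" by (rule subring_set_laurent_ring)
  \<comment> \<open>Comparison of coefficients should give A_e = P^(-e) B_(-e). Multiplication by
    P^N makes all exponents of \<open>P\<close> nonnegative on the range, so the comparison takes
    place over \<open>face l\<close>, where \<open>P\<close> need not be invertible.\<close>
  define C where "C e = P ^ nat N * A e - P ^ nat (N - e) * B (- e)" for e
  have "(\<Sum>e\<in>{-N..N}. y l powi e * C e) = P ^ nat N * (\<Sum>e\<in>{-N..N}. y l powi e * A e)
      - (\<Sum>e\<in>{-N..N}. y l powi e * (P ^ nat (N - e) * B (- e)))"
    by (simp add: C_def right_diff_distrib sum_subtractf sum_distrib_left mult_ac)
  also have "(\<Sum>e\<in>{-N..N}. y l powi e * (P ^ nat (N - e) * B (- e)))
      = (\<Sum>e\<in>{-N..N}. y l powi (- e) * (P ^ nat (N + e) * B e))"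
    by (rule sum.reindex_bij_witness[of _ uminus uminus]) auto
  also have "\<dots> = (\<Sum>e\<in>{-N..N}. P ^ nat N * ((P / y l) powi e * B e))"
  proof (rule sum.cong[OF HOL.refl])
    fix e assume e: "e \<in> {-N..N}"
    have "P ^ nat (N + e) = P powi (N + e)" using e by (simp add: power_int_def)
    also have "\<dots> = P ^ nat N * P powi e" using e P(2)
      by (simp add: power_int_add) (simp add: power_int_def)
    finally show "y l powi (- e) * (P ^ nat (N + e) * B e) = P ^ nat N * ((P / y l) powi e * B e)"
      by (simp add: power_int_divide_distrib power_int_minus field_simps)
  qed
  finally have "(\<Sum>e\<in>{-N..N}. y l powi e * C e) = 0"
    by (simp add: eq sum_distrib_left)
  moreover have "C e \<in> face l" for e
    unfolding C_def using A B P by (intro R.closed)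
  ultimately have "C (- e) = 0"
    using e by (intro graded_eq_0D[of "{-N..N}" C]) auto
  then have "P ^ nat N * A (- e) = P ^ nat (N + e) * B e" by (simp add: C_def)
  also have "P ^ nat (N + e) = P powi (N + e)" using e by (simp add: power_int_def)
  also have "\<dots> = P ^ nat N * P powi e" using e P(2)
    by (simp add: power_int_add) (simp add: power_int_def)
  finally show ?thesis using P(2) by simp
qed

text \<open>Grouped by the exponent of the mutated variable, a relation among the new monomials
  becomes an expansion in powers of \<open>P / y l\<close> that equals the zero expansion in powers
  of \<open>y l\<close>. By \<open>graded_mutation\<close> each group vanishes; multiplied by a
  power of \<open>y l\<close>, it is a relation among the old monomials.\<close>

lemma laurent_frame_mutation:
  assumes P: "P \<in> face l" "P \<noteq> 0"
  shows "laurent_frame K (y(l := P / y l))"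
proof
  show "(y(l := P / y l)) i \<noteq> 0" for i using nz P(2) by simp
  fix S :: "('v \<Rightarrow> int) set" and c m
  assume S: "finite S" and cK: "\<And>m. m \<in> S \<Longrightarrow> c m \<in> K"
    and sum: "(\<Sum>m\<in>S. c m * lmonom (y(l := P / y l)) m) = 0" and m: "m \<in> S"
  interpret R: subring_set "face l" by (rule subring_set_laurent_ring)
  define N where "N = Max ((\<lambda>m. \<bar>m l\<bar>) ` S)"
  have N: "m l \<in> {-N..N}" if "m \<in> S" for m
  proof -
    have "\<bar>m l\<bar> \<le> N" unfolding N_def using S that by (intro Max_ge) auto
    then show ?thesis by auto
  qed
  define B where "B e = (\<Sum>m | m \<in> S \<and> m l = e. c m * lmonom (y(l := 1)) m)" for e
  have B: "B e \<in> face l" for e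
    unfolding B_def using cK by (intro R.sum_closed R.mult_closed laurent_ring_base lmonom_laurent_ring) auto
  have "(\<Sum>e\<in>{-N..N}. (P / y l) powi e * B e)
      = (\<Sum>e\<in>{-N..N}. \<Sum>m | m \<in> S \<and> m l = e. c m * lmonom (y(l := P / y l)) m)"
    unfolding B_def sum_distrib_left
    by (intro sum.cong HOL.refl) (auto simp: lmonom_upd[of y l "P / y l"] mult_ac)
  also have "\<dots> = (\<Sum>m\<in>S. c m * lmonom (y(l := P / y l)) m)"
    by (rule sum.group) (use S N in auto)
  finally have "(\<Sum>e\<in>{-N..N}. y l powi e * 0) = (\<Sum>e\<in>{-N..N}. (P / y l) powi e * B e)"
    using sum by simp
  from graded_mutation[OF R.zero_closed B P this N[OF m]]
  have "B (m l) = 0" using P(2) by simp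
  then have "(\<Sum>n | n \<in> S \<and> n l = m l. c n * lmonom y n) = y l powi m l * 0"
    unfolding B_def
    by (subst \<open>B (m l) = 0\<close>[symmetric], unfold B_def sum_distrib_left)
      (intro sum.cong HOL.refl, auto simp: lmonom_split[of y _ l] mult_ac)
  then have "(\<Sum>n | n \<in> S \<and> n l = m l. c n * lmonom y n) = 0" by simp
  from indep[OF _ _ this, of m] show "c m = 0" using S cK m by simp
qed

text \<open>The terms of the expansions of \<open>f\<close> in powers of \<open>y l\<close> and of
  \<open>P / y l\<close> agree one by one, so the coefficient of (y_l)^(-k) is P^k times that of (P
  / y_l)^k.\<close>

lemma slice_divisible:
  assumes P: "P \<in> face l" "P \<noteq> 0"
    and f: "f \<in> L" "f \<in> laurent_ring K (y(l := P / y l))"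
  shows "\<exists>B\<in>face l. \<forall>m. m l = 0 \<longrightarrow> lcoeff f (m(l := - int k)) = lcoeff (P ^ k * B) m"
proof -
  let ?z = "y(l := P / y l)"
  have nzz: "?z i \<noteq> 0" for i using nz P(2) by simp
  obtain A M where A: "\<And>e. A e \<in> face l"
    and fA: "\<And>N. N \<ge> M \<Longrightarrow> f = (\<Sum>e\<in>{-N..N::int}. y l powi e * A e)"
    using laurent_ring_graded[OF K nz f(1), of l] by blast
  obtain B M' where B: "\<And>e. B e \<in> face l"
    and fB: "\<And>N. N \<ge> M' \<Longrightarrow> f = (\<Sum>e\<in>{-N..N::int}. (P / y l) powi e * B e)"
    using laurent_ring_graded[OF K nzz f(2), of l] by auto
  define N where "N = max (int k) (max M M')"
  have k: "int k \<in> {-N..N}" by (auto simp: N_def)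
  have "A (- int k) = P powi int k * B (int k)"
    by (rule graded_mutation[OF A B P _ k]) (use fA[of N] fB[of N] in \<open>simp add: N_def\<close>)
  then have "A (- int k) = P ^ k * B (int k)" by simp
  moreover have "lcoeff f (m(l := - int k)) = lcoeff (A (- int k)) m" if "m l = 0" for m
  proof -
    have "m(l := 0) = m" using that by auto
    then show ?thesis
      using lcoeff_graded[OF _ A, where E = "{-N..N}" and m = "m(l := - int k)"] fA[of N] k
      by (simp add: N_def)
  qed
  ultimately show ?thesis using B by metis
qed

end

section \<open>Elements of negative degree\<close>

lemma UNIV_3: "(UNIV :: 3 set) = {l, l + 1, l + 2}"
proof -
  have "i \<in> {l, l + 1, l + 2}" for i
    using type_3_cases[of l] type_3_cases[of i] by auto
  then show ?thesis by blast
qed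

lemma sum_3: "sum f (UNIV :: 3 set) = f l + f (l + 1) + (f (l + 2) :: 'a::comm_monoid_add)"
  by (subst UNIV_3[of l]) (simp add: add.assoc)

lemma prod_3: "prod f (UNIV :: 3 set) = f l * f (l + 1) * (f (l + 2) :: 'a::comm_monoid_mult)"
  by (subst UNIV_3[of l]) (simp add: mult.assoc)

text \<open>Multiplication by the monomial with all exponents \<open>N\<close> turns a relation
  among Laurent monomials into one among ordinary monomials. The truncation by \<open>nat\<close> in
  \<open>\<phi>\<close> does not take effect on \<open>S\<close>, which is why \<open>\<phi>\<close>
  is injective there.\<close>

lemma alg_independent_imp_laurent_frame:
  assumes K: "subring_set K" and ind: "alg_independent K x"
  shows "laurent_frame K x"
proof (rule laurent_frame.intro[OF K])
  interpret K: subring_set K by fact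
  show nz: "x i \<noteq> 0" for i
  proof
    assume x: "x i = 0"
    define P where "P = Poly_Mapping.single (Poly_Mapping.single i (1::nat)) (1::'a)"
    have "mpoly_eval x P = (\<Prod>j\<in>UNIV. x j ^ Poly_Mapping.lookup (Poly_Mapping.single i 1) j)"
      by (simp add: mpoly_eval_def P_def)
    also have "\<dots> = 0"
      using x by (intro prod_zero) (auto intro!: bexI[of _ i])
    finally have "P = 0"
      using ind by (auto simp: alg_independent_def P_def lookup_single when_def K.zero_closed K.one_closed)
    then have "Poly_Mapping.lookup P (Poly_Mapping.single i 1) = 0" by simp
    then show False by (simp add: P_def del: One_nat_def)
  qed
  fix S c m
  assume S: "finite S" and cK: "\<And>m. m \<in> S \<Longrightarrow> c m \<in> K"
    and sum: "(\<Sum>m\<in>S. c m * lmonom x m) = 0" and m: "m \<in> S"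
  define N where "N = Max ((\<lambda>(m, i). \<bar>m i\<bar>) ` (S \<times> UNIV))"
  have N: "0 \<le> m i + N" if "m \<in> S" for m i
  proof -
    have "\<bar>m i\<bar> \<le> N" unfolding N_def using S that by (intro Max_ge) auto
    then show ?thesis by auto
  qed
  define \<phi> where "\<phi> m = Abs_poly_mapping (\<lambda>i. nat (m i + N))" for m :: "'b \<Rightarrow> int"
  have \<phi>: "Poly_Mapping.lookup (\<phi> m) i = nat (m i + N)" for m i
    unfolding \<phi>_def by (subst lookup_Abs_poly_mapping) auto
  have inj: "m = n" if "m \<in> S" "n \<in> S" "\<phi> m = \<phi> n" for m n
  proof
    fix i
    have "nat (m i + N) = nat (n i + N)" using that(3) by (simp flip: \<phi>)
    then show "m i = n i" using N[of m i] N[of n i] that by simp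
  qed
  define P where "P = (\<Sum>m\<in>S. Poly_Mapping.single (\<phi> m) (c m))"
  have P: "Poly_Mapping.lookup P n = (\<Sum>m\<in>S. if \<phi> m = n then c m else 0)" for n
    by (simp add: P_def lookup_sum lookup_single when_def)
  have P\<phi>: "Poly_Mapping.lookup P (\<phi> m) = c m" if "m \<in> S" for m
  proof -
    have "Poly_Mapping.lookup P (\<phi> m) = (\<Sum>n\<in>S. if n = m then c n else 0)"
      unfolding P by (intro sum.cong HOL.refl) (auto dest: inj[OF _ that])
    then show ?thesis using S that by simp
  qed
  have "mpoly_eval x P = (\<Sum>n\<in>\<phi> ` S. Poly_Mapping.lookup P n * (\<Prod>i\<in>UNIV. x i ^ Poly_Mapping.lookup n i))"
    unfolding mpoly_eval_def
  proof (rule sum.mono_neutral_left)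
    show "Poly_Mapping.keys P \<subseteq> \<phi> ` S"
    proof
      fix n assume "n \<in> Poly_Mapping.keys P"
      then have "(\<Sum>m\<in>S. if \<phi> m = n then c m else 0) \<noteq> 0" by (simp add: P in_keys_iff)
      then show "n \<in> \<phi> ` S" by (auto elim!: sum.not_neutral_contains_not_neutral split: if_splits)
    qed
  qed (use S in \<open>auto simp: in_keys_iff\<close>)
  also have "\<dots> = (\<Sum>m\<in>S. c m * (\<Prod>i\<in>UNIV. x i ^ nat (m i + N)))"
  proof -
    have "inj_on \<phi> S" by (intro inj_onI inj)
    then show ?thesis by (simp add: sum.reindex P\<phi> \<phi>)
  qed
  also have "\<dots> = (\<Sum>m\<in>S. c m * lmonom x (m + (\<lambda>_. N)))"
    unfolding lmonom_def
    by (intro sum.cong HOL.refl arg_cong2[where f = "(*)"] prod.cong)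
      (use N in \<open>auto simp: power_int_def\<close>)
  also have "\<dots> = (\<Sum>m\<in>S. c m * lmonom x m) * lmonom x (\<lambda>_. N)"
    by (simp add: lmonom_add[OF nz] sum_distrib_left mult_ac)
  finally have "mpoly_eval x P = 0" by (simp add: sum)
  moreover have "Poly_Mapping.lookup P n \<in> K" for n
    unfolding P by (intro K.sum_closed) (auto intro: cK K.zero_closed)
  ultimately have "P = 0" using ind unfolding alg_independent_def by blast
  then show "c m = 0" using P\<phi>[OF m] by simp
qed

text \<open>Multiplication of a Laurent polynomial in one variable z by z^a + 1, on coefficient
  functions.\<close>

definition spread_step :: "int \<Rightarrow> (int \<Rightarrow> 'f::field) \<Rightarrow> int \<Rightarrow> 'f" where
  "spread_step a g t = g (t - a) + g t"

text \<open>Each step moves the top term up by \<open>a\<close> and leaves the bottom term in place.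
  Nothing cancels at the two ends, in whatever characteristic; the nonzero value at \<open>s\<close>
  only has to exclude g = 0.\<close>

lemma spread_step_iterate:
  assumes fin: "finite {t. g t \<noteq> 0}" and a: "a > 0" and nz: "(spread_step a ^^ k) g s \<noteq> 0"
  shows "\<exists>u v. (spread_step a ^^ k) g u \<noteq> 0 \<and> (spread_step a ^^ k) g v \<noteq> 0 \<and> u - v \<ge> a * int k"
proof -
  let ?T = "{t. g t \<noteq> 0}"
  define M where "M = Max ?T"
  define m where "m = Min ?T"
  have ne: "?T \<noteq> {}"
  proof
    assume "?T = {}"
    then have "g = (\<lambda>_. 0)" by auto
    then have "(spread_step a ^^ k) g = (\<lambda>_. 0)"
      by (induction k) (auto simp: spread_step_def)
    with nz show False by simp
  qed
  have "M \<in> ?T" "m \<in> ?T" unfolding M_def m_def by (rule Max_in[OF fin ne], rule Min_in[OF fin ne])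
  then have M: "g M \<noteq> 0" and m: "g m \<noteq> 0" by auto
  have above: "g t = 0" if "t > M" for t
    using that Max_ge[OF fin, of t] unfolding M_def by force
  have below: "g t = 0" if "t < m" for t
    using that Min_le[OF fin, of t] unfolding m_def by force
  have "(spread_step a ^^ k) g (M + a * int k) \<noteq> 0 \<and> (\<forall>t>M + a * int k. (spread_step a ^^ k) g t = 0)"
  proof (induction k)
    case (Suc k)
    then show ?case using a by (simp add: spread_step_def algebra_simps)
  qed (use M above in auto)
  moreover have "(spread_step a ^^ k) g m \<noteq> 0 \<and> (\<forall>t<m. (spread_step a ^^ k) g t = 0)"
  proof (induction k)
    case (Suc k)
    then show ?case using a by (simp add: spread_step_def)
  qed (use m below in auto)
  moreover have "m \<le> M" using M below by force
  ultimately show ?thesis by (intro exI[of _ "M + a * int k"] exI[of _ m]) auto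
qed

text \<open>Addition on the type \<open>3\<close> is cyclic. The number of arrows between two
  vertices is \<open>a\<close> times the weight of the opposite vertex. The two orientations of the
  cycle give the same binomial, with its summands swapped.\<close>

definition exchange :: "nat \<Rightarrow> (3 \<Rightarrow> nat) \<Rightarrow> (3 \<Rightarrow> 'f::field) \<Rightarrow> 3 \<Rightarrow> 'f" where
  "exchange a d y l = y (l + 1) ^ (a * d (l + 2)) + y (l + 2) ^ (a * d (l + 1))"

lemma (in laurent_frame) exchange_nonzero:
  assumes "i \<noteq> j" "b > 0"
  shows "y i ^ b + y j ^ c \<noteq> 0"
proof
  have y: "y i ^ b = lmonom y (0(i := int b))" for i b by (simp only: lmonom_single power_int_of_nat)
  have "lcoeff (y i ^ b) (0(i := int b)) = 1"
    unfolding y using lcoeff_mon[OF K.one_closed] by simp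
  moreover have "lcoeff (y j ^ c) (0(i := int b)) = 0"
  proof -
    have "0(i := int b) \<noteq> 0(j := int c)" using assms by (auto simp: fun_eq_iff split: if_splits)
    then show ?thesis unfolding y using lcoeff_mon[OF K.one_closed, of "0(j := int c)"] by simp
  qed
  moreover have "y i ^ b \<in> L" "y j ^ c \<in> L" by (intro L.power_closed laurent_ring_var)+
  moreover assume "y i ^ b + y j ^ c = 0"
  ultimately show False using lcoeff_add[of "y i ^ b" "y j ^ c" "0(i := int b)"] by simp
qed

lemma power_in_face: "i \<noteq> l \<Longrightarrow> y i ^ b \<in> laurent_ring K (y(l := 1))"
proof -
  interpret subring_set "laurent_ring K (y(l := 1))" by (rule subring_set_laurent_ring)
  assume "i \<noteq> l"
  then show ?thesis using power_closed[OF laurent_ring_var[of "y(l := 1)" i K]] by simp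
qed

lemma exchange_in_face: "exchange a d y l \<in> laurent_ring K (y(l := 1))"
proof -
  interpret subring_set "laurent_ring K (y(l := 1))" by (rule subring_set_laurent_ring)
  show ?thesis unfolding exchange_def by (intro add_closed power_in_face) auto
qed

text \<open>
  In degree $d$, let $k$ be the largest pole order of $f$ along one of the cluster variables,
  say along $y_l$. The coefficient of $y_l^{-k}$ is divisible by the $k$-th power of
  $y_{l+1}^a + y_{l+2}^a$, so its exponents of $y_{l+1}$ spread over at least $ak \ge 3k$.
  By maximality of $k$ they spread over at most $d + 3k$.
\<close>

lemma degree_nonneg:
  fixes y :: "3 \<Rightarrow> 'f::field"
  assumes frame: "laurent_frame K y" and a: "a \<ge> 3"
    and f: "f \<in> laurent_ring K y"
    and fl: "\<And>l. f \<in> laurent_ring K (y(l := exchange a (\<lambda>_. 1) y l / y l))"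
    and m0: "laurent_frame.lcoeff K y f m\<^sub>0 \<noteq> 0"
  shows "sum m\<^sub>0 UNIV \<ge> 0"
proof (rule ccontr)
  interpret laurent_frame K y by fact
  define d where "d = sum m\<^sub>0 UNIV"
  assume "\<not> sum m\<^sub>0 UNIV \<ge> 0"
  then have d: "d < 0" by (simp add: d_def)
  define Deg where "Deg = {m. lcoeff f m \<noteq> 0 \<and> sum m UNIV = d}"
  have "finite Deg" unfolding Deg_def using finite_lcoeff[OF f] by (rule rev_finite_subset) auto
  have m0_Deg: "m\<^sub>0 \<in> Deg" using m0 by (simp add: Deg_def d_def)
  define Z where "Z = (\<lambda>(m, i). - (m i)) ` (Deg \<times> UNIV)"
  have Z: "finite Z" "Z \<noteq> {}" using \<open>finite Deg\<close> m0_Deg by (auto simp: Z_def)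
  define k' where "k' = Max Z"
  have bound: "- k' \<le> m i" if "m \<in> Deg" for m i
  proof -
    have "- (m i) \<in> Z" using that by (force simp: Z_def)
    then have "- (m i) \<le> k'" unfolding k'_def using Z by simp
    then show ?thesis by simp
  qed
  have "- k' + - k' + - k' \<le> d"
    unfolding d_def sum_3[of _ 1] using bound[OF m0_Deg] by (intro add_mono)
  with d have "k' > 0" by simp
  then obtain k where k: "k' = int k" by (metis zero_less_imp_eq_int)
  have "k' \<in> Z" unfolding k'_def using Z by simp
  then obtain m\<^sub>1 l where m1: "m\<^sub>1 \<in> Deg" "m\<^sub>1 l = - int k" by (auto simp: Z_def k)
  let ?P = "y (l + 1) ^ a + y (l + 2) ^ a"
  have P: "?P \<in> face l" "?P \<noteq> 0" "?P \<in> L"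
    using exchange_in_face[of a "\<lambda>_. 1" y l K] exchange_nonzero[of "l + 1" "l + 2" a a] a
      face_subset[of l]
    by (auto simp: exchange_def)
  obtain B where B: "B \<in> face l"
    and slice: "\<And>m. m l = 0 \<Longrightarrow> lcoeff f (m(l := - int k)) = lcoeff (?P ^ k * B) m"
    using slice_divisible[OF P(1,2) f, of k] fl[of l] by (auto simp: exchange_def)
  \<comment> \<open>Multiplication by \<open>?P\<close> raises the degree by \<open>a\<close> and
    does not involve \<open>y l\<close>. So it acts separately on each line of exponents of fixed
    degree \<open>e\<close> with entry 0 at \<open>l\<close>; such a line is parametrized by the
    exponent of \<open>y (l + 1)\<close>.\<close>
  define expo where "expo s t = (0 :: 3 \<Rightarrow> int)(l + 1 := s, l + 2 := t)" for s t
  define line where "line G e t = lcoeff G (expo t (e - t))" for G e t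
  have mult_P: "line (?P * G) e = spread_step (int a) (line G (e - int a))" if G: "G \<in> L" for G e
  proof
    fix t
    have y: "y i ^ a = lmonom y (0(i := int a))" for i by (simp only: lmonom_single power_int_of_nat)
    have "lcoeff (?P * G) (expo t (e - t))
        = lcoeff (y (l + 1) ^ a * G) (expo t (e - t)) + lcoeff (y (l + 2) ^ a * G) (expo t (e - t))"
      unfolding distrib_right by (intro lcoeff_add L.mult_closed L.power_closed laurent_ring_var G)
    also have "lcoeff (y (l + 1) ^ a * G) (expo t (e - t)) = lcoeff G (expo (t - int a) (e - t))"
      unfolding y lcoeff_mult_mon[OF G]
      by (intro arg_cong[of _ _ "lcoeff G"]) (auto simp: expo_def fun_eq_iff)
    also have "lcoeff (y (l + 2) ^ a * G) (expo t (e - t)) = lcoeff G (expo t (e - t - int a))"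
      unfolding y lcoeff_mult_mon[OF G]
      by (intro arg_cong[of _ _ "lcoeff G"]) (auto simp: expo_def fun_eq_iff)
    finally show "line (?P * G) e t = spread_step (int a) (line G (e - int a)) t"
      by (simp add: line_def spread_step_def algebra_simps)
  qed
  have BL: "B \<in> L" using B face_subset by blast
  have line: "line (?P ^ n * B) e = (spread_step (int a) ^^ n) (line B (e - int a * int n))" for n e
  proof (induction n arbitrary: e)
    case (Suc n)
    have "line (?P ^ Suc n * B) e = line (?P * (?P ^ n * B)) e" by (simp only: power_Suc mult.assoc)
    also have "\<dots> = spread_step (int a) (line (?P ^ n * B) (e - int a))"
      by (intro mult_P L.mult_closed L.power_closed P BL)
    also have "\<dots> = spread_step (int a) ((spread_step (int a) ^^ n) (line B (e - int a - int a * int n)))"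
      by (simp only: Suc.IH)
    also have "e - int a - int a * int n = e - int a * int (Suc n)"
      by (simp add: algebra_simps)
    finally show ?case by (simp only: funpow.simps comp_apply)
  qed simp
  \<comment> \<open>The factor (y_l)^(-k) accounts for -k of the degree d, which leaves d + k for
    the other two variables.\<close>
  define e where "e = d + int k"
  define g where "g = line B (e - int a * int k)"
  have expo: "expo s t l = 0" "expo s t (l + 1) = s" "expo s t (l + 2) = t" for s t
    by (simp_all add: expo_def)
  have lcoeff: "lcoeff f ((expo t (e - t))(l := - int k)) = (spread_step (int a) ^^ k) g t" for t
  proof -
    have "lcoeff f ((expo t (e - t))(l := - int k)) = lcoeff (?P ^ k * B) (expo t (e - t))"
      by (rule slice) (rule expo(1))
    also have "\<dots> = line (?P ^ k * B) e t" by (simp only: line_def)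
    finally show ?thesis by (simp only: line g_def)
  qed
  have in_Deg: "(expo t (e - t))(l := - int k) \<in> Deg" if "(spread_step (int a) ^^ k) g t \<noteq> 0" for t
  proof -
    have "lcoeff f ((expo t (e - t))(l := - int k)) \<noteq> 0" unfolding lcoeff by (rule that)
    moreover have "sum ((expo t (e - t))(l := - int k)) UNIV = d"
      by (simp add: sum_3[of _ l] expo e_def)
    ultimately show ?thesis unfolding Deg_def by blast
  qed
  have "finite {t. g t \<noteq> 0}"
  proof (rule finite_subset)
    show "{t. g t \<noteq> 0} \<subseteq> (\<lambda>m. m (l + 1)) ` {m. lcoeff B m \<noteq> 0}"
    proof
      fix t assume "t \<in> {t. g t \<noteq> 0}"
      then have "lcoeff B (expo t (e - int a * int k - t)) \<noteq> 0" by (simp add: g_def line_def)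
      then have "expo t (e - int a * int k - t) \<in> {m. lcoeff B m \<noteq> 0}" by blast
      then show "t \<in> (\<lambda>m. m (l + 1)) ` {m. lcoeff B m \<noteq> 0}"
        by (rule rev_image_eqI) (simp only: expo)
    qed
    show "finite ((\<lambda>m. m (l + 1)) ` {m. lcoeff B m \<noteq> 0})"
      using finite_lcoeff[OF BL] by simp
  qed
  moreover have "int a > 0" using a by simp
  moreover have "(spread_step (int a) ^^ k) g (m\<^sub>1 (l + 1)) \<noteq> 0"
  proof -
    have "sum m\<^sub>1 UNIV = d" using m1 by (simp add: Deg_def)
    then have m1_l2: "m\<^sub>1 (l + 2) = e - m\<^sub>1 (l + 1)"
      using m1(2) by (simp add: sum_3[of _ l] e_def)
    have "((expo (m\<^sub>1 (l + 1)) (e - m\<^sub>1 (l + 1)))(l := - int k)) i = m\<^sub>1 i" for i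
    proof -
      have "i \<in> {l, l + 1, l + 2}" using UNIV_3[of l] by blast
      then show ?thesis using m1(2) m1_l2 by (auto simp: expo)
    qed
    then have "(expo (m\<^sub>1 (l + 1)) (e - m\<^sub>1 (l + 1)))(l := - int k) = m\<^sub>1" by blast
    moreover have "lcoeff f m\<^sub>1 \<noteq> 0" using m1(1) by (simp add: Deg_def)
    ultimately show ?thesis using lcoeff[of "m\<^sub>1 (l + 1)"] by metis
  qed
  ultimately have "\<exists>u v. (spread_step (int a) ^^ k) g u \<noteq> 0 \<and>
      (spread_step (int a) ^^ k) g v \<noteq> 0 \<and> u - v \<ge> int a * int k"
    by (rule spread_step_iterate)
  then obtain u v where uv: "(spread_step (int a) ^^ k) g u \<noteq> 0"
      "(spread_step (int a) ^^ k) g v \<noteq> 0" "u - v \<ge> int a * int k"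
    by blast
  have "- int k \<le> e - u" using bound[OF in_Deg[OF uv(1)], of "l + 2"] by (simp add: k expo)
  moreover have "- int k \<le> v" using bound[OF in_Deg[OF uv(2)], of "l + 1"] by (simp add: k expo)
  moreover have "int a * int k \<ge> 3 * int k" using a by (intro mult_right_mono) auto
  ultimately show False using uv(3) d by (simp add: e_def)
qed

section \<open>Invariance of the upper bound under mutation\<close>

lemma (in subring_set) power_add_expand:
  assumes "A \<in> L" "B \<in> L"
  shows "\<exists>S\<in>L. (A + B) ^ n = A ^ n + B * S"
proof (induction n)
  case (Suc n)
  then obtain S where S: "S \<in> L" "(A + B) ^ n = A ^ n + B * S" by blast
  have "(A + B) ^ Suc n = A ^ Suc n + B * (A * S + (A ^ n + B * S))"
    by (simp add: S(2) algebra_simps)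
  moreover have "A * S + (A ^ n + B * S) \<in> L"
    by (intro add_closed mult_closed power_closed assms S(1))
  ultimately show ?case by blast
qed (auto intro: zero_closed)

lemma (in subring_set) comaximal_power:
  assumes st: "s \<in> L" "t \<in> L" "\<alpha> \<in> L" "\<beta> \<in> L" "\<alpha> * s + \<beta> * t = 1"
  shows "\<exists>\<gamma>\<in>L. \<exists>\<delta>\<in>L. \<gamma> * s ^ n + \<delta> * t = 1"
proof (induction n)
  case 0
  show ?case by (intro bexI[of _ 1] bexI[of _ 0]) (auto intro: one_closed zero_closed)
next
  case (Suc n)
  then obtain \<gamma> \<delta> where *: "\<gamma> \<in> L" "\<delta> \<in> L" "\<gamma> * s ^ n + \<delta> * t = 1" by blast
  have "1 = (\<gamma> * s ^ n + \<delta> * t) * (\<alpha> * s + \<beta> * t)" by (simp add: * st)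
  also have "\<dots> = (\<gamma> * \<alpha>) * s ^ Suc n + (\<gamma> * s ^ n * \<beta> + \<delta> * (\<alpha> * s + \<beta> * t)) * t"
    by (simp add: algebra_simps)
  finally have "(\<gamma> * \<alpha>) * s ^ Suc n + (\<gamma> * s ^ n * \<beta> + \<delta> * (\<alpha> * s + \<beta> * t)) * t = 1" ..
  moreover have "\<gamma> * \<alpha> \<in> L" "\<gamma> * s ^ n * \<beta> + \<delta> * (\<alpha> * s + \<beta> * t) \<in> L"
    by (intro add_closed mult_closed power_closed * st(1-4))+
  ultimately show ?case by blast
qed

text \<open>Powers of comaximal elements are comaximal; a combination of \<open>s ^ m\<close> and
  \<open>t ^ n\<close> equal to 1, multiplied by \<open>f\<close>, exhibits \<open>f\<close> as an
  element of \<open>L\<close>. In other words, the localizations of \<open>L\<close> at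
  \<open>s\<close> and at \<open>t\<close> meet in \<open>L\<close>.\<close>

lemma (in subring_set) comaximal_localization:
  assumes st: "s \<in> L" "t \<in> L" "\<alpha> \<in> L" "\<beta> \<in> L" "\<alpha> * s + \<beta> * t = 1"
    and f: "f * s ^ m \<in> L" "f * t ^ n \<in> L"
  shows "f \<in> L"
proof -
  obtain \<gamma> \<delta> where 1: "\<gamma> \<in> L" "\<delta> \<in> L" "\<gamma> * s ^ m + \<delta> * t = 1"
    using comaximal_power[OF st] by blast
  then have "\<delta> * t + \<gamma> * s ^ m = 1" by (simp add: add.commute)
  then obtain \<alpha>' \<beta>' where 2: "\<alpha>' \<in> L" "\<beta>' \<in> L" "\<alpha>' * t ^ n + \<beta>' * s ^ m = 1"
    using comaximal_power[of t "s ^ m" \<delta> \<gamma>] 1 st power_closed by blast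
  have "f = f * (\<alpha>' * t ^ n + \<beta>' * s ^ m)" by (simp add: 2)
  also have "\<dots> = \<alpha>' * (f * t ^ n) + \<beta>' * (f * s ^ m)" by (simp add: algebra_simps)
  also have "\<dots> \<in> L" by (intro add_closed mult_closed f 2)
  finally show ?thesis .
qed

text \<open>
  \<open>x\<^sub>0, \<dots>, x\<^sub>4\<close> are the variables met when mutating in two alternating directions. Modulo \<open>x\<^sub>2\<close> the product
  \<open>x\<^sub>0 * x\<^sub>1\<close> is a monomial in the units \<open>x\<^sub>3\<close>, \<open>x\<^sub>4\<close> and \<open>z\<close>.
\<close>

lemma (in subring_set) rank_2_comaximal:
  assumes unit: "x\<^sub>3 \<in> L" "inverse x\<^sub>3 \<in> L" "x\<^sub>4 \<in> L" "inverse x\<^sub>4 \<in> L" "z \<in> L" "inverse z \<in> L"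
    and nz: "x\<^sub>2 \<noteq> 0" "x\<^sub>3 \<noteq> 0" "x\<^sub>4 \<noteq> 0" "z \<noteq> 0"
    and x4: "x\<^sub>2 * x\<^sub>4 = x\<^sub>3 ^ b + z ^ c\<^sub>3"
    and x3: "x\<^sub>1 * x\<^sub>3 = x\<^sub>2 ^ b + z ^ c\<^sub>2"
    and x2: "x\<^sub>0 * x\<^sub>2 = x\<^sub>1 ^ b + z ^ c\<^sub>1"
    and c: "c\<^sub>1 + c\<^sub>3 = b * c\<^sub>2" and b: "b \<ge> 2"
  shows "x\<^sub>2 \<in> L" "x\<^sub>1 \<in> L" "x\<^sub>0 \<in> L" "\<exists>\<alpha>\<in>L. \<exists>\<beta>\<in>L. \<alpha> * (x\<^sub>0 * x\<^sub>1) + \<beta> * x\<^sub>2 = 1"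
proof -
  have "x\<^sub>2 = (x\<^sub>3 ^ b + z ^ c\<^sub>3) * inverse x\<^sub>4" using x4 nz by (simp add: field_simps)
  also have "\<dots> \<in> L" by (intro add_closed mult_closed power_closed unit)
  finally show x2_in: "x\<^sub>2 \<in> L" .
  have "x\<^sub>1 = (x\<^sub>2 ^ b + z ^ c\<^sub>2) * inverse x\<^sub>3" using x3 nz by (simp add: field_simps)
  also have "\<dots> \<in> L" by (intro add_closed mult_closed power_closed unit x2_in)
  finally show "x\<^sub>1 \<in> L" .
  \<comment> \<open>By \<open>c\<close> the leading part of this power is
    \<open>z ^ c\<^sub>1 * z ^ c\<^sub>3\<close>. Together with
    \<open>z ^ c\<^sub>1 * x\<^sub>3 ^ b\<close> it makes up a multiple of
    \<open>x\<^sub>2 * x\<^sub>4\<close>, so a factor \<open>x\<^sub>2\<close> can be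
    cancelled.\<close>
  obtain S where S: "S \<in> L" and "(z ^ c\<^sub>2 + x\<^sub>2 ^ b) ^ b = (z ^ c\<^sub>2) ^ b + x\<^sub>2 ^ b * S"
    using power_add_expand[of "z ^ c\<^sub>2" "x\<^sub>2 ^ b" b] unit x2_in power_closed by blast
  then have expand: "(x\<^sub>1 * x\<^sub>3) ^ b = z ^ c\<^sub>1 * z ^ c\<^sub>3 + x\<^sub>2 ^ b * S"
    by (simp add: x3 add.commute c mult.commute flip: power_mult power_add)
  \<comment> \<open>As b is at least 2, the remainder is still divisible by \<open>x\<^sub>2\<close>
    after one such factor has been cancelled.\<close>
  obtain n where n: "b = Suc (Suc n)" using b by (metis add_2_eq_Suc le_Suc_ex)
  have "x\<^sub>2 * (x\<^sub>0 * x\<^sub>3 ^ b) = (x\<^sub>0 * x\<^sub>2) * x\<^sub>3 ^ b" by simp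
  also have "\<dots> = (x\<^sub>1 * x\<^sub>3) ^ b + z ^ c\<^sub>1 * x\<^sub>3 ^ b"
    by (simp only: x2 distrib_right power_mult_distrib)
  also have "\<dots> = z ^ c\<^sub>1 * (x\<^sub>3 ^ b + z ^ c\<^sub>3) + x\<^sub>2 ^ b * S"
    by (simp only: expand) (simp add: algebra_simps)
  also have "\<dots> = x\<^sub>2 * (z ^ c\<^sub>1 * x\<^sub>4 + x\<^sub>2 * (x\<^sub>2 ^ n * S))"
    unfolding x4[symmetric] by (simp add: n algebra_simps)
  finally have x0: "x\<^sub>0 * x\<^sub>3 ^ b = z ^ c\<^sub>1 * x\<^sub>4 + x\<^sub>2 * (x\<^sub>2 ^ n * S)" using nz by simp
  have "x\<^sub>0 = (z ^ c\<^sub>1 * x\<^sub>4 + x\<^sub>2 * (x\<^sub>2 ^ n * S)) * inverse x\<^sub>3 ^ b"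
    unfolding x0[symmetric] using nz by (simp add: power_inverse)
  also have "\<dots> \<in> L" by (intro add_closed mult_closed power_closed unit x2_in S)
  finally show "x\<^sub>0 \<in> L" .
  \<comment> \<open>\<open>x\<^sub>2 * W\<close> is the part of the product divisible by
    \<open>x\<^sub>2\<close>, and \<open>r\<close> is the inverse of the unit that remains modulo
    \<open>x\<^sub>2\<close>.\<close>
  define W where "W = x\<^sub>2 ^ n * S * (x\<^sub>2 ^ b + z ^ c\<^sub>2) + z ^ c\<^sub>1 * x\<^sub>4 * x\<^sub>2 ^ Suc n"
  define r where "r = inverse z ^ (c\<^sub>1 + c\<^sub>2) * inverse x\<^sub>4"
  have "(x\<^sub>0 * x\<^sub>1) * x\<^sub>3 ^ Suc b = (x\<^sub>0 * x\<^sub>3 ^ b) * (x\<^sub>1 * x\<^sub>3)" by (simp add: mult_ac)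
  also have "\<dots> = z ^ (c\<^sub>1 + c\<^sub>2) * x\<^sub>4 + x\<^sub>2 * W"
    unfolding x0 x3 W_def by (simp add: n algebra_simps power_add)
  finally have "r * ((x\<^sub>0 * x\<^sub>1) * x\<^sub>3 ^ Suc b) = r * (z ^ (c\<^sub>1 + c\<^sub>2) * x\<^sub>4) + r * (x\<^sub>2 * W)"
    by (simp only: distrib_left)
  moreover have "r * (z ^ (c\<^sub>1 + c\<^sub>2) * x\<^sub>4) = 1"
    using nz by (simp add: r_def power_inverse field_simps)
  ultimately have "(r * x\<^sub>3 ^ Suc b) * (x\<^sub>0 * x\<^sub>1) + (- (r * W)) * x\<^sub>2 = 1"
    by (simp add: algebra_simps)
  moreover have "r * x\<^sub>3 ^ Suc b \<in> L" "- (r * W) \<in> L"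
    unfolding r_def W_def by (intro uminus_closed add_closed mult_closed power_closed unit x2_in S)+
  ultimately show "\<exists>\<alpha>\<in>L. \<exists>\<beta>\<in>L. \<alpha> * (x\<^sub>0 * x\<^sub>1) + \<beta> * x\<^sub>2 = 1" by blast
qed

text \<open>
  The seeds that are mutation equivalent to the cyclic seed have $a d_i$ arrows opposite to each
  vertex $i$, where $d$ solves the following equation of Markov type; $d_i$ is the degree of the
  cluster variable at $i$.
\<close>

definition markov :: "nat \<Rightarrow> (3 \<Rightarrow> nat) \<Rightarrow> bool" where
  "markov a d \<longleftrightarrow> (\<forall>i. d i > 0) \<and> (\<Sum>i\<in>UNIV. d i ^ 2) + a = a * (\<Prod>i\<in>UNIV. d i) + 3"

text \<open>Vieta's involution: as a quadratic equation in the weight at \<open>l\<close>, the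
  Markov equation has \<open>a * d (l + 1) * d (l + 2)\<close> as the sum of its roots.\<close>

definition mutate_degree :: "nat \<Rightarrow> 3 \<Rightarrow> (3 \<Rightarrow> nat) \<Rightarrow> 3 \<Rightarrow> nat" where
  "mutate_degree a l d = d(l := a * d (l + 1) * d (l + 2) - d l)"

definition mutate_cluster :: "nat \<Rightarrow> (3 \<Rightarrow> nat) \<Rightarrow> 3 \<Rightarrow> (3 \<Rightarrow> 'f::field) \<Rightarrow> 3 \<Rightarrow> 'f" where
  "mutate_cluster a d l y = y(l := exchange a d y l / y l)"

text \<open>Only one orientation is encoded. The opposite one appears with the arguments
  \<open>i\<close> and \<open>j\<close> swapped, and each mutation passes from one to the
  other.\<close>

definition weighted_quiver :: "nat \<Rightarrow> (3 \<Rightarrow> nat) \<Rightarrow> 3 quiver" where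
  "weighted_quiver a d i j = (if j = i + 1 then a * d (i + 2) else 0)"

text \<open>The product of the two roots is d(l+1)^2 + d(l+2)^2 + a - 3, which is positive for a at
  least 3. Hence the subtraction in \<open>mutate_degree\<close> is a true one and the new weight is
  positive.\<close>

lemma markov_less:
  assumes "markov a d" "a \<ge> 3"
  shows "d l < a * d (l + 1) * d (l + 2)"
proof -
  have eq: "d l ^ 2 + d (l + 1) ^ 2 + d (l + 2) ^ 2 + a = d l * (a * d (l + 1) * d (l + 2)) + 3"
    and pos: "d l > 0" "d (l + 1) > 0" "d (l + 2) > 0"
    using assms(1) unfolding markov_def sum_3[of _ l] prod_3[of _ l] by (simp_all add: mult_ac)
  have "d (l + 1) ^ 2 > 0" using pos by simp
  then have "d l * d l < d l * (a * d (l + 1) * d (l + 2))"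
    using eq assms(2) unfolding power2_eq_square by linarith
  then show ?thesis by simp
qed

lemma markov_mutate_degree:
  assumes "markov a d" "a \<ge> 3"
  shows "markov a (mutate_degree a l d)"
proof -
  define s where "s = a * d (l + 1) * d (l + 2)"
  obtain d' where d': "s = d l + d'" "d' > 0"
    using markov_less[OF assms, of l] unfolding s_def by (metis less_imp_add_positive)
  have eq: "d l ^ 2 + d (l + 1) ^ 2 + d (l + 2) ^ 2 + a = d l * s + 3"
    and pos: "\<And>i. d i > 0"
    using assms(1) unfolding markov_def sum_3[of _ l] prod_3[of _ l] s_def by (simp_all add: mult_ac)
  have "d (l + 1) ^ 2 + d (l + 2) ^ 2 + a = d l * d' + 3"
    using eq unfolding d' by (simp add: power2_eq_square algebra_simps)
  then have "d' ^ 2 + d (l + 1) ^ 2 + d (l + 2) ^ 2 + a = d' * s + 3"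
    unfolding d' by (simp add: power2_eq_square algebra_simps)
  then show ?thesis
    using pos d' unfolding markov_def sum_3[of _ l] prod_3[of _ l]
    by (simp add: mutate_degree_def mult_ac flip: s_def)
      (simp add: s_def mult_ac)
qed

lemma mod_3_simps: "(4 :: 3) = 1" "(5 :: 3) = 2" "4 + l = l + (1 :: 3)" "1 + l = l + (1 :: 3)" "3 + l = (l :: 3)"
  by (simp_all add: add.commute)

text \<open>The composites through \<open>l\<close> run against the \<open>a * d l\<close> arrows
  between the other two vertices and outnumber them by \<open>markov_less\<close>. What survives the
  cancellation is \<open>a\<close> times the new weight, and the triangle stays a directed
  cycle.\<close>

lemma mutate_weighted_quiver:
  assumes "markov a d" "a \<ge> 3"
  shows "mutate_quiver l (weighted_quiver a d) = (\<lambda>i j. weighted_quiver a (mutate_degree a l d) j i)"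
    and "mutate_quiver l (\<lambda>i j. weighted_quiver a d j i) = weighted_quiver a (mutate_degree a l d)"
proof -
  have le: "a * d l \<le> a * d (l + 1) * (a * d (l + 2))"
    using markov_less[OF assms, of l] mult_le_mono2[of "d l" "a * d (l + 1) * d (l + 2)" a]
    by (simp add: mult_ac)
  have vertex: "i = l \<or> i = l + 1 \<or> i = l + 2" for i using UNIV_3[of l] by auto
  have quiver: "weighted_quiver a e l (l + 1) = a * e (l + 2)"
    "weighted_quiver a e (l + 1) (l + 2) = a * e l"
    "weighted_quiver a e (l + 2) l = a * e (l + 1)"
    "weighted_quiver a e (l + 1) l = 0" "weighted_quiver a e (l + 2) (l + 1) = 0"
    "weighted_quiver a e l (l + 2) = 0" "weighted_quiver a e i i = 0" for e i
    by (simp_all add: weighted_quiver_def mod_3_simps)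
  have degree: "mutate_degree a l d l = a * d (l + 1) * d (l + 2) - d l"
    "mutate_degree a l d (l + 1) = d (l + 1)" "mutate_degree a l d (l + 2) = d (l + 2)"
    by (simp_all add: mutate_degree_def)
  have new: "a * (a * d (l + 1) * d (l + 2) - d l) = a * d (l + 1) * (a * d (l + 2)) - a * d l"
    by (simp add: diff_mult_distrib2 mult_ac)
  note mutate = mutate_quiver_def cancel_2_cycles_def reverse_at_def add_composites_def
  have "mutate_quiver l (weighted_quiver a d) i j = weighted_quiver a (mutate_degree a l d) j i" for i j
    using vertex[of i] vertex[of j] le by (elim disjE) (simp_all add: mutate quiver degree new)
  then show "mutate_quiver l (weighted_quiver a d) = (\<lambda>i j. weighted_quiver a (mutate_degree a l d) j i)"
    by blast
  have "mutate_quiver l (\<lambda>i j. weighted_quiver a d j i) i j = weighted_quiver a (mutate_degree a l d) i j" for i j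
    using vertex[of i] vertex[of j] le
    by (elim disjE) (simp_all add: mutate quiver degree new mult.commute)
  then show "mutate_quiver l (\<lambda>i j. weighted_quiver a d j i) = weighted_quiver a (mutate_degree a l d)"
    by blast
qed

section \<open>Two successive mutations in different directions\<close>

lemma UNIV_distinct_3:
  assumes "l \<noteq> m" "m \<noteq> n" "l \<noteq> n"
  shows "(UNIV :: 3 set) = {l, m, n}"
  by (rule sym, rule card_subset_eq) (use assms in auto)

lemma exchange_distinct:
  assumes "l \<noteq> m" "m \<noteq> n" "l \<noteq> n"
  shows "exchange a d y l = y m ^ (a * d n) + y n ^ (a * d m)"
  using assms type_3_cases[of l] type_3_cases[of m] type_3_cases[of n]
  by (auto simp: exchange_def mod_3_simps(1,2) add.commute)

lemma mutate_degree_distinct: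
  assumes "l \<noteq> m" "m \<noteq> n" "l \<noteq> n"
  shows "mutate_degree a l d l = a * d m * d n - d l"
  using assms type_3_cases[of l] type_3_cases[of m] type_3_cases[of n]
  by (auto simp: mutate_degree_def mod_3_simps(1,2) mult_ac)

lemma laurent_frame_mutate_cluster:
  assumes "laurent_frame K y" "a > 0" "\<And>i. d i > 0"
  shows "laurent_frame K (mutate_cluster a d l y)"
proof -
  interpret laurent_frame K y by fact
  have "exchange a d y l \<noteq> 0"
    unfolding exchange_def using assms by (intro exchange_nonzero) auto
  then show ?thesis unfolding mutate_cluster_def
    by (rule laurent_frame_mutation[OF exchange_in_face])
qed

text \<open>The upper bound of Berenstein, Fomin and Zelevinsky.\<close>

definition upper_bound :: "'f::field set \<Rightarrow> nat \<Rightarrow> (3 \<Rightarrow> nat) \<Rightarrow> (3 \<Rightarrow> 'f) \<Rightarrow> 'f set" where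
  "upper_bound K a d y = laurent_ring K y \<inter> (\<Inter>l. laurent_ring K (mutate_cluster a d l y))"

text \<open>Both \<open>y'\<close> and the mutation \<open>w\<close> of \<open>y\<close> at
  \<open>m\<close> consist of elements of the target ring. Clearing denominators from
  \<open>y'\<close> costs a power of \<open>y m\<close>, and from \<open>w\<close> a power of
  \<open>w m * y l\<close>; these are comaximal in that ring.\<close>

lemma upper_bound_mutate_aux:
  assumes frame: "laurent_frame K y" and a: "a \<ge> 3" and d: "markov a d"
    and f: "f \<in> upper_bound K a d y" and dist: "l \<noteq> m" "m \<noteq> n" "l \<noteq> n"
  shows "f \<in> laurent_ring K (mutate_cluster a (mutate_degree a l d) m (mutate_cluster a d l y))"
proof -
  define d' where "d' = mutate_degree a l d"
  define y' where "y' = mutate_cluster a d l y"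
  define y'' where "y'' = mutate_cluster a d' m y'"
  define w where "w = mutate_cluster a d m y"
  have d': "markov a d'" unfolding d'_def by (rule markov_mutate_degree[OF d a])
  have pos: "d i > 0" "d' i > 0" for i using d d' by (simp_all add: markov_def)
  have frames: "laurent_frame K y'" "laurent_frame K y''" "laurent_frame K w"
    using a pos frame unfolding y'_def y''_def w_def
    by (auto intro!: laurent_frame_mutate_cluster)
  note nz = laurent_frame.nz[OF frame] laurent_frame.nz[OF frames(1)] laurent_frame.nz[OF frames(2)]
    laurent_frame.nz[OF frames(3)]
  interpret subring_set "laurent_ring K y''" by (rule subring_set_laurent_ring)
  note dist' = dist dist[symmetric]
  have vals: "y' m = y m" "y' n = y n" "y'' l = y' l" "y'' n = y n" "w l = y l" "w n = y n"
    using dist' by (simp_all add: y'_def y''_def w_def mutate_cluster_def)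
  have y'l: "y l * y' l = y m ^ (a * d n) + y n ^ (a * d m)"
    using nz exchange_distinct[OF dist, of a d y] by (simp add: y'_def mutate_cluster_def)
  have wm: "w m * y m = y l ^ (a * d n) + y n ^ (a * d l)"
    using nz exchange_distinct[of m l n a d y] dist' by (simp add: w_def mutate_cluster_def)
  have y''m: "y m * y'' m = y' l ^ (a * d n) + y n ^ (a * d' l)"
    using nz exchange_distinct[of m l n a d' y'] dist'
    by (simp add: y''_def mutate_cluster_def vals d'_def mutate_degree_def)
  have "d l \<le> a * d m * d n"
    using markov_less[OF d a, of l] pos(2)[of l] mutate_degree_distinct[OF dist, of a d]
    by (simp add: d'_def)
  \<comment> \<open>The rule for new degrees is the relation between exponents that
    \<open>rank_2_comaximal\<close> asks for.\<close>
  then have c: "a * d l + a * d' l = a * d n * (a * d m)"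
    by (simp add: d'_def mutate_degree_distinct[OF dist] diff_mult_distrib2 mult_ac)
  have "1 * 2 \<le> d n * a" using pos(1)[of n] a by (intro mult_mono) auto
  then have b: "a * d n \<ge> 2" by (simp add: mult.commute)
  have units: "y' l \<in> laurent_ring K y''" "inverse (y' l) \<in> laurent_ring K y''"
    "y'' m \<in> laurent_ring K y''" "inverse (y'' m) \<in> laurent_ring K y''"
    "y n \<in> laurent_ring K y''" "inverse (y n) \<in> laurent_ring K y''"
    by (metis laurent_ring_var laurent_ring_inverse vals)+
  \<comment> \<open>The chain from \<open>x\<^sub>0\<close> to \<open>x\<^sub>4\<close> is
    \<open>w m\<close>, \<open>y l\<close>, \<open>y m\<close>, \<open>y' l\<close>,
    \<open>y'' m\<close>, and \<open>z\<close> is \<open>y n\<close>.\<close>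
  note com = rank_2_comaximal[OF units nz(1) nz(2) nz(3) nz(1) y''m y'l wm c b]
  obtain \<alpha> \<beta> where \<alpha>\<beta>: "\<alpha> \<in> laurent_ring K y''" "\<beta> \<in> laurent_ring K y''"
      "\<alpha> * (w m * y l) + \<beta> * y m = 1"
    using com(4) by blast
  have UNIV: "i = l \<or> i = m \<or> i = n" for i using UNIV_distinct_3[OF dist] by auto
  have prod: "(\<Prod>i\<in>UNIV. g i) = g l * g m * g n" for g :: "3 \<Rightarrow> 'a"
    unfolding UNIV_distinct_3[OF dist] using dist by (simp add: mult_ac)
  have K: "K \<subseteq> laurent_ring K y''" by (auto intro: laurent_ring_base)
  have "y' i \<in> laurent_ring K y''" for i
    using UNIV[of i] units com vals by auto
  moreover have "f \<in> laurent_ring K y'" using f by (auto simp: upper_bound_def y'_def)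
  ultimately obtain N where "f * (\<Prod>i\<in>UNIV. y' i) ^ N \<in> laurent_ring K y''"
    using laurent_ring_clear_denominators[OF subring_set_axioms K] nz(2) by blast
  then have "f * (\<Prod>i\<in>UNIV. y' i) ^ N * (inverse (y' l) ^ N * inverse (y n) ^ N) \<in> laurent_ring K y''"
    by (rule mult_closed) (intro mult_closed power_closed units)
  also have "f * (\<Prod>i\<in>UNIV. y' i) ^ N * (inverse (y' l) ^ N * inverse (y n) ^ N) = f * y m ^ N"
    using nz by (simp add: prod vals power_mult_distrib power_inverse field_simps)
  finally have 1: "f * y m ^ N \<in> laurent_ring K y''" .
  have "w i \<in> laurent_ring K y''" for i
    using UNIV[of i] units com vals by auto
  moreover have "f \<in> laurent_ring K w" using f by (auto simp: upper_bound_def w_def)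
  ultimately obtain M where "f * (\<Prod>i\<in>UNIV. w i) ^ M \<in> laurent_ring K y''"
    using laurent_ring_clear_denominators[OF subring_set_axioms K] nz(4) by blast
  then have "f * (\<Prod>i\<in>UNIV. w i) ^ M * inverse (y n) ^ M \<in> laurent_ring K y''"
    by (rule mult_closed) (intro mult_closed power_closed units)
  also have "f * (\<Prod>i\<in>UNIV. w i) ^ M * inverse (y n) ^ M = f * (w m * y l) ^ M"
    using nz by (simp add: prod vals power_mult_distrib power_inverse field_simps)
  finally have 2: "f * (w m * y l) ^ M \<in> laurent_ring K y''" .
  have "f \<in> laurent_ring K y''"
    by (rule comaximal_localization[OF mult_closed[OF com(3,2)] com(1) \<alpha>\<beta> 2 1])
  then show ?thesis by (simp add: y''_def y'_def d'_def)
qed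

text \<open>The exchange binomial at \<open>l\<close> involves neither \<open>y l\<close> nor
  \<open>d l\<close>, so both mutations divide the same binomial.\<close>

lemma mutate_cluster_involution:
  assumes "laurent_frame K y" "a > 0" "\<And>i. d i > 0"
  shows "mutate_cluster a (mutate_degree a l d) l (mutate_cluster a d l y) = y"
proof -
  have nz: "y l \<noteq> 0" "mutate_cluster a d l y l \<noteq> 0"
    using laurent_frame.nz[OF assms(1)] laurent_frame.nz[OF laurent_frame_mutate_cluster[OF assms]] by auto
  have "exchange a (mutate_degree a l d) (mutate_cluster a d l y) l = exchange a d y l"
    by (simp add: exchange_def mutate_cluster_def mutate_degree_def)
  then show ?thesis using nz by (simp add: mutate_cluster_def)
qed

text \<open>Mutating again at \<open>l\<close> returns to the old cluster, so only the other two
  directions need the comaximality argument.\<close>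

lemma upper_bound_mutate:
  assumes "laurent_frame K y" "a \<ge> 3" "markov a d"
  shows "upper_bound K a d y \<subseteq> upper_bound K a (mutate_degree a l d) (mutate_cluster a d l y)"
proof
  fix f assume f: "f \<in> upper_bound K a d y"
  have "f \<in> laurent_ring K (mutate_cluster a (mutate_degree a l d) m (mutate_cluster a d l y))" for m
  proof (cases "m = l")
    case True
    have "d i > 0" for i using assms(3) by (simp add: markov_def)
    then show ?thesis
      using f mutate_cluster_involution[of K y a d l] assms True by (auto simp: upper_bound_def)
  next
    case False
    obtain n where "n \<noteq> l" "n \<noteq> m"
      using type_3_cases[of l] type_3_cases[of m] that[of 1] that[of 2] that[of 3] by auto
    then show ?thesis using upper_bound_mutate_aux[OF assms f, of l m n] False by auto
  qed
  then show "f \<in> upper_bound K a (mutate_degree a l d) (mutate_cluster a d l y)"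
    using f by (auto simp: upper_bound_def)
qed

section \<open>The upper cluster algebra equals the initial upper bound\<close>

lemma mutate_seed_cluster:
  assumes "quiver T = weighted_quiver a d \<or> quiver T = (\<lambda>i j. weighted_quiver a d j i)"
  shows "cluster (mutate_seed l T) = mutate_cluster a d l (cluster T)"
  using assms
  by (auto simp: mutate_seed_def mutate_cluster_def mutate_var_def exchange_def
      prod_3[of _ l] weighted_quiver_def mod_3_simps(3,4) add.commute[of _ "cluster T (l + 1) ^ _"] intro!: arg_cong2[where f = "(/)"])

lemma cyclic_quiver_eq: "cyclic_quiver a = weighted_quiver a (\<lambda>_. 1)"
proof (intro ext)
  fix i j :: 3
  show "cyclic_quiver a i j = weighted_quiver a (\<lambda>_. 1) i j"
    using type_3_cases[of i] type_3_cases[of j]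
    by (auto simp: cyclic_quiver_def weighted_quiver_def)
qed

lemma upper_bound_subset_upper_cluster_algebra:
  assumes frame: "laurent_frame K x" and a: "a \<ge> 3"
  shows "upper_bound K a (\<lambda>_. 1) x \<subseteq> upper_cluster_algebra K (cyclic_seed a x)"
proof
  fix f assume f: "f \<in> upper_bound K a (\<lambda>_. 1) x"
  have "\<exists>d. markov a d \<and> (quiver T = weighted_quiver a d \<or> quiver T = (\<lambda>i j. weighted_quiver a d j i))
      \<and> laurent_frame K (cluster T) \<and> f \<in> upper_bound K a d (cluster T)"
    if "mutation_equivalent (cyclic_seed a x) T" for T
    using that
  proof induction
    case refl
    have "markov a (\<lambda>_. 1)" by (simp add: markov_def)
    then show ?case
      using frame f by (intro exI[of _ "\<lambda>_. 1"]) (simp add: cyclic_seed_def cyclic_quiver_eq)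
  next
    case (mutate T l)
    then obtain d where d: "markov a d"
      and Q: "quiver T = weighted_quiver a d \<or> quiver T = (\<lambda>i j. weighted_quiver a d j i)"
      and T: "laurent_frame K (cluster T)" "f \<in> upper_bound K a d (cluster T)" by blast
    have pos: "a > 0" "d i > 0" for i using d a by (simp_all add: markov_def)
    have "quiver (mutate_seed l T) = weighted_quiver a (mutate_degree a l d)
        \<or> quiver (mutate_seed l T) = (\<lambda>i j. weighted_quiver a (mutate_degree a l d) j i)"
      using Q mutate_weighted_quiver[OF d a, of l] by (auto simp: mutate_seed_def)
    moreover have "laurent_frame K (cluster (mutate_seed l T))"
      "f \<in> upper_bound K a (mutate_degree a l d) (cluster (mutate_seed l T))"
      using laurent_frame_mutate_cluster[OF T(1) pos] upper_bound_mutate[OF T(1) a d] T(2)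
      by (auto simp: mutate_seed_cluster[OF Q])
    ultimately show ?case using markov_mutate_degree[OF d a] by blast
  qed
  then show "f \<in> upper_cluster_algebra K (cyclic_seed a x)"
    unfolding upper_cluster_algebra_def upper_bound_def by blast
qed

lemma upper_cluster_algebra_subset_upper_bound:
  "upper_cluster_algebra K (cyclic_seed a x) \<subseteq> upper_bound K a (\<lambda>_. 1) x"
proof -
  have "mutation_equivalent (cyclic_seed a x) (cyclic_seed a x)"
    "mutation_equivalent (cyclic_seed a x) (mutate_seed l (cyclic_seed a x))" for l
    by (auto intro!: mutation_equivalent.intros simp: cyclic_seed_def)
  moreover have "cluster (mutate_seed l (cyclic_seed a x)) = mutate_cluster a (\<lambda>_. 1) l x" for l
    using mutate_seed_cluster[of "cyclic_seed a x" a "\<lambda>_. 1" l]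
    by (simp add: cyclic_seed_def cyclic_quiver_eq)
  moreover have "cluster (cyclic_seed a x) = x" by (simp add: cyclic_seed_def)
  ultimately show ?thesis unfolding upper_cluster_algebra_def upper_bound_def by fastforce
qed

text \<open>This places the monomials of the initial cluster and of its neighbours in the algebra,
  on which \<open>\<theta>\<close> is going to be additive and compatible with q-th powers.\<close>

lemma cluster_variables_in_upper_bound:
  assumes frame: "laurent_frame K y" and "a > 0" "\<And>i. d i > 0"
  shows "y i \<in> upper_bound K a d y" "mutate_cluster a d i y i \<in> upper_bound K a d y"
proof -
  note nz = laurent_frame.nz[OF frame]
  have ex: "exchange a d y l \<in> laurent_ring K z" if "\<And>j. j \<noteq> l \<Longrightarrow> y j \<in> laurent_ring K z" for l z
  proof -
    interpret subring_set "laurent_ring K z" by (rule subring_set_laurent_ring)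
    show ?thesis unfolding exchange_def by (intro add_closed power_closed that) auto
  qed
  have y: "y j \<in> laurent_ring K (mutate_cluster a d l y)" for j l
  proof (cases "j = l")
    case False
    then show ?thesis using laurent_ring_var[of "mutate_cluster a d l y" j K]
      by (simp add: mutate_cluster_def)
  next
    case True
    interpret subring_set "laurent_ring K (mutate_cluster a d l y)" by (rule subring_set_laurent_ring)
    have "y j \<in> laurent_ring K (mutate_cluster a d l y)" if "j \<noteq> l" for j
      using laurent_ring_var[of "mutate_cluster a d l y" j K] that by (simp add: mutate_cluster_def)
    then have "exchange a d y l * inverse (mutate_cluster a d l y l) \<in> laurent_ring K (mutate_cluster a d l y)"
      by (intro mult_closed ex laurent_ring_inverse)
    moreover have "mutate_cluster a d l y l \<noteq> 0"
      using laurent_frame.nz[OF laurent_frame_mutate_cluster[OF assms]] .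
    ultimately show ?thesis using nz True by (simp add: mutate_cluster_def)
  qed
  then show "y i \<in> upper_bound K a d y"
    by (auto simp: upper_bound_def intro: laurent_ring_var)
  have "mutate_cluster a d i y i \<in> laurent_ring K z"
    if "\<And>j. y j \<in> laurent_ring K z" "inverse (y i) \<in> laurent_ring K z" for z
  proof -
    interpret subring_set "laurent_ring K z" by (rule subring_set_laurent_ring)
    have "exchange a d y i * inverse (y i) \<in> laurent_ring K z"
      using that by (intro mult_closed ex)
    then show ?thesis by (simp add: mutate_cluster_def divide_inverse)
  qed
  note * = this
  have "mutate_cluster a d i y i \<in> laurent_ring K (mutate_cluster a d l y)" for l
  proof (cases "l = i")
    case True
    then show ?thesis by (auto intro: laurent_ring_var)
  next
    case False
    then show ?thesis
      using laurent_ring_inverse[of "mutate_cluster a d l y" i K]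
      by (intro * y) (simp add: mutate_cluster_def)
  qed
  then show "mutate_cluster a d i y i \<in> upper_bound K a d y"
    using *[of y] by (auto simp: upper_bound_def intro: laurent_ring_var laurent_ring_inverse)
qed

section \<open>Inverse Frobenius-linear maps\<close>

text \<open>Frobenius is injective, so roots are unique and the chosen \<open>root\<close> is
  additive. Composing with it removes the algebraic closure from all later computations.\<close>

lemma frobenius_hom_imp_inverse_linear:
  fixes R :: "'f::field set"
  assumes hom: "frobenius_hom e R \<psi>" and p: "CHAR('f) > 0"
  defines "q \<equiv> CHAR('f) ^ e"
  obtains \<theta> where "\<And>f. f \<in> R \<Longrightarrow> \<theta> f \<in> R"
    and "\<And>f g. f \<in> R \<Longrightarrow> g \<in> R \<Longrightarrow> \<theta> (f + g) = \<theta> f + \<theta> g"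
    and "\<And>r f. r \<in> R \<Longrightarrow> f \<in> R \<Longrightarrow> \<theta> (r ^ q * f) = r * \<theta> f"
    and "\<And>f y. y ^ q = to_ac f \<Longrightarrow> \<theta> f = \<psi> y"
proof -
  have prime: "prime CHAR('f alg_closure)" using p by (simp add: prime_CHAR_semidom)
  have q: "q = CHAR('f alg_closure) ^ e" by (simp add: q_def)
  have "q > 0" using p by (simp add: q_def)
  have frob: "(y + z) ^ q = y ^ q + z ^ q" for y z :: "'f alg_closure"
    using freshmans_dream'[OF prime q] .
  have inj: "y = z" if "y ^ q = z ^ q" for y z :: "'f alg_closure"
  proof -
    have "y ^ q = (y - z) ^ q + z ^ q" using frob[of "y - z" z] by simp
    with that \<open>q > 0\<close> show ?thesis by simp
  qed
  define root where "root f = (SOME y. y ^ q = to_ac f)" for f :: 'f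
  have root: "root f ^ q = to_ac f" for f
    unfolding root_def by (rule someI_ex) (use nth_root_exists[OF \<open>q > 0\<close>] in blast)
  have roots: "root f \<in> frobenius_roots e R" if "f \<in> R" for f
    using root[of f] that by (auto simp: frobenius_roots_def q_def)
  have add: "root (f + g) = root f + root g" for f g
    by (rule inj) (simp add: root frob)
  have scale: "root (r ^ q * f) = to_ac r * root f" for r f
    by (rule inj) (simp add: root power_mult_distrib)
  have unique: "root f = y" if "y ^ q = to_ac f" for f y
    by (rule inj) (simp only: root that)
  show ?thesis
  proof (rule that[of "\<lambda>f. \<psi> (root f)"])
    show "\<psi> (root f) = \<psi> y" if "y ^ q = to_ac f" for f y
      by (simp only: unique[OF that])
  qed (use hom roots in \<open>simp_all add: frobenius_hom_def add scale\<close>)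
qed

text \<open>
  \<open>\<theta>\<close> plays the role of $f \mapsto \psi(f^{1/q})$. Relative to a cluster $u, v, w$, the element
  \<open>dual u v w\<close> is the $h$ with $\psi(f^{1/q}) = \varphi((hf)^{1/q})$ for the monomial splitting
  $\varphi$ of that cluster, written in terms of the values of $\theta$ on a monomial basis.
\<close>

locale inverse_frobenius_linear = subring_set L for L :: "'f::field set" +
  fixes q :: nat and \<theta> :: "'f \<Rightarrow> 'f"
  assumes q: "q > 0"
    and frobenius: "(f + g :: 'f) ^ q = f ^ q + g ^ q"
    and theta_add: "f \<in> L \<Longrightarrow> g \<in> L \<Longrightarrow> \<theta> (f + g) = \<theta> f + \<theta> g"
    and theta_scale: "r \<in> L \<Longrightarrow> f \<in> L \<Longrightarrow> \<theta> (r ^ q * f) = r * \<theta> f"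
begin

text \<open>The directions \<open>v\<close> and \<open>w\<close> are summed out, with
  \<open>f\<close> in place of a power of \<open>u\<close>: this isolates what a mutation at
  \<open>u\<close> leaves alone. For nonzero \<open>v\<close> and \<open>w\<close> in
  \<open>L\<close> the summand depends on \<open>j\<close> and \<open>k\<close> only modulo
  \<open>q\<close>. The range \<open>{1..q}\<close> keeps the arguments of \<open>\<theta>\<close>
  in \<open>L\<close> and contains the exponent 1 even if q = 1.\<close>

definition partial_dual :: "'f \<Rightarrow> 'f \<Rightarrow> 'f \<Rightarrow> 'f" where
  "partial_dual v w f = (\<Sum>j\<in>{1..q}. \<Sum>k\<in>{1..q}. \<theta> (f * v ^ j * w ^ k) ^ q / (v ^ j * w ^ k))"

definition dual :: "'f \<Rightarrow> 'f \<Rightarrow> 'f \<Rightarrow> 'f" where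
  "dual u v w = (\<Sum>i\<in>{1..q}. partial_dual v w (u ^ i) / u ^ i)"

lemma partial_dual_commute: "partial_dual v w f = partial_dual w v f"
  unfolding partial_dual_def by (subst sum.swap) (simp add: mult_ac)

lemma dual_eq:
  "dual u v w = (\<Sum>i\<in>{1..q}. \<Sum>j\<in>{1..q}. \<Sum>k\<in>{1..q}.
     \<theta> (u ^ i * v ^ j * w ^ k) ^ q / (u ^ i * v ^ j * w ^ k))"
  unfolding dual_def partial_dual_def by (simp add: sum_divide_distrib mult_ac)

lemma dual_rotate: "dual u v w = dual v w u"
proof -
  have "dual u v w = (\<Sum>j\<in>{1..q}. \<Sum>i\<in>{1..q}. \<Sum>k\<in>{1..q}.
     \<theta> (u ^ i * v ^ j * w ^ k) ^ q / (u ^ i * v ^ j * w ^ k))"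
    unfolding dual_eq by (rule sum.swap)
  also have "\<dots> = (\<Sum>j\<in>{1..q}. \<Sum>k\<in>{1..q}. \<Sum>i\<in>{1..q}.
     \<theta> (u ^ i * v ^ j * w ^ k) ^ q / (u ^ i * v ^ j * w ^ k))"
    by (intro sum.cong HOL.refl sum.swap)
  finally show ?thesis unfolding dual_eq by (simp add: mult_ac)
qed

lemma partial_dual_add:
  assumes "v \<in> L" "w \<in> L" "f \<in> L" "g \<in> L"
  shows "partial_dual v w (f + g) = partial_dual v w f + partial_dual v w g"
proof -
  have "\<theta> ((f + g) * v ^ j * w ^ k) ^ q = \<theta> (f * v ^ j * w ^ k) ^ q + \<theta> (g * v ^ j * w ^ k) ^ q" for j k
    unfolding distrib_right frobenius[symmetric]
    by (intro arg_cong[of _ _ "\<lambda>x. x ^ q"] theta_add) (intro mult_closed power_closed assms)+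
  then show ?thesis
    unfolding partial_dual_def by (simp add: add_divide_distrib sum.distrib)
qed

lemma partial_dual_scale:
  assumes "v \<in> L" "w \<in> L" "r \<in> L" "f \<in> L"
  shows "partial_dual v w (r ^ q * f) = r ^ q * partial_dual v w f"
proof -
  have "\<theta> (r ^ q * f * v ^ j * w ^ k) = r * \<theta> (f * v ^ j * w ^ k)" for j k
    using theta_scale[of r "f * v ^ j * w ^ k"] assms power_closed mult_closed by (simp add: mult.assoc)
  then show ?thesis
    unfolding partial_dual_def by (simp add: sum_distrib_left power_mult_distrib)
qed

text \<open>Multiplication by \<open>v\<close> shifts the index \<open>j\<close> by one. The term j
  = q + 1 that enters equals the term j = 1 that leaves, because \<open>\<theta>\<close> turns a
  factor v^q into v.\<close>

lemma partial_dual_mult: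
  assumes "v \<in> L" "w \<in> L" "f \<in> L" "v \<noteq> 0"
  shows "partial_dual v w (v * f) = v * partial_dual v w f"
proof -
  define g where "g j = (\<Sum>k\<in>{1..q}. \<theta> (f * v ^ j * w ^ k) ^ q / (v ^ j * w ^ k))" for j
  have "\<theta> (f * v ^ Suc q * w ^ k) = v * \<theta> (f * v * w ^ k)" for k
    using theta_scale[of v "f * v * w ^ k"] assms power_closed mult_closed by (simp add: mult_ac)
  then have g: "g (Suc q) = g 1"
    using assms(4) by (simp add: g_def power_mult_distrib)
  have "partial_dual v w (v * f) = (\<Sum>j\<in>{1..q}. v * g (Suc j))"
    unfolding partial_dual_def g_def sum_distrib_left
    using assms(4) by (intro sum.cong HOL.refl) (simp add: mult_ac)
  also have "\<dots> = v * (\<Sum>j\<in>{Suc 1..Suc q}. g j)"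
    by (simp only: sum_distrib_left sum.shift_bounds_cl_Suc_ivl)
  also have "(\<Sum>j\<in>{Suc 1..Suc q}. g j) = (\<Sum>j\<in>{1..q}. g j)"
  proof -
    have "(\<Sum>j\<in>{1..Suc q}. g j) = g 1 + (\<Sum>j\<in>{Suc 1..Suc q}. g j)"
      by (rule sum.atLeast_Suc_atMost) simp
    moreover have "(\<Sum>j\<in>{1..Suc q}. g j) = (\<Sum>j\<in>{1..q}. g j) + g (Suc q)" by simp
    ultimately show ?thesis using g by simp
  qed
  finally show ?thesis by (simp add: partial_dual_def g_def)
qed

lemma partial_dual_mult_power:
  assumes "v \<in> L" "w \<in> L" "f \<in> L" "v \<noteq> 0"
  shows "partial_dual v w (v ^ n * f) = v ^ n * partial_dual v w f"
proof (induction n)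
  case (Suc n)
  have "partial_dual v w (v * (v ^ n * f)) = v * partial_dual v w (v ^ n * f)"
    by (intro partial_dual_mult mult_closed power_closed assms)
  then show ?case by (simp add: Suc.IH mult.assoc)
qed simp

lemma partial_dual_mult_binomial:
  assumes "v \<in> L" "w \<in> L" "f \<in> L" "v \<noteq> 0" "w \<noteq> 0"
  shows "partial_dual v w ((v ^ b + w ^ c) ^ n * f) = (v ^ b + w ^ c) ^ n * partial_dual v w f"
proof (induction n)
  case (Suc n)
  let ?g = "(v ^ b + w ^ c) ^ n * f"
  have g: "?g \<in> L" by (intro add_closed mult_closed power_closed assms)
  have "partial_dual v w ((v ^ b + w ^ c) ^ Suc n * f) = partial_dual v w (v ^ b * ?g + w ^ c * ?g)"
    by (simp add: algebra_simps)
  also have "\<dots> = partial_dual v w (v ^ b * ?g) + partial_dual w v (w ^ c * ?g)"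
    unfolding partial_dual_commute[of w v] by (intro partial_dual_add mult_closed power_closed assms g)
  also have "partial_dual v w (v ^ b * ?g) = v ^ b * partial_dual v w ?g"
    by (intro partial_dual_mult_power assms g)
  also have "partial_dual w v (w ^ c * ?g) = w ^ c * partial_dual w v ?g"
    by (intro partial_dual_mult_power assms g)
  also have "v ^ b * partial_dual v w ?g + w ^ c * partial_dual w v ?g
      = (v ^ b + w ^ c) * partial_dual v w ?g"
    by (simp only: partial_dual_commute[of w v] distrib_right)
  finally show ?case by (simp add: Suc.IH mult.assoc)
qed simp

text \<open>Since u' = (v^b + w^c) / u, the power u'^i is (v^b + w^c)^i u^(q-i) / u^q. The binomial
  and the q-th power come out of \<open>partial_dual\<close>, so the term i for \<open>u'\<close> is
  the term q - i for \<open>u\<close>. The term i = q is \<open>partial_dual v w 1\<close> for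
  both.\<close>

lemma dual_mutate:
  assumes in_L: "u \<in> L" "u' \<in> L" "v \<in> L" "w \<in> L" and nz: "u \<noteq> 0" "u' \<noteq> 0" "v \<noteq> 0" "w \<noteq> 0"
    and u': "u * u' = v ^ b + w ^ c"
  shows "dual u' v w = dual u v w"
proof -
  let ?t = "\<lambda>u i. partial_dual v w (u ^ i) / u ^ i"
  have split: "dual u v w = (\<Sum>i\<in>{1..<q}. ?t u i) + ?t u q" for u
    using q by (simp add: dual_def atLeastLessThanSuc_atLeastAtMost[symmetric] sum.last_plus add.commute)
  have last: "?t u q = partial_dual v w 1" if "u \<in> L" "u \<noteq> 0" for u
    using partial_dual_scale[OF in_L(3,4) that(1) one_closed] that(2) by simp
  have "?t u' i = ?t u (q - i)" if i: "i \<in> {1..<q}" for i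
  proof -
    have uq: "u ^ q = u ^ i * u ^ (q - i)" using i by (simp flip: power_add)
    have "u ^ q * partial_dual v w (u' ^ i) = partial_dual v w (u ^ q * u' ^ i)"
      by (rule partial_dual_scale[symmetric]) (intro power_closed in_L)+
    also have "u ^ q * u' ^ i = (v ^ b + w ^ c) ^ i * u ^ (q - i)"
      unfolding uq u'[symmetric] by (simp add: power_mult_distrib)
    also have "partial_dual v w \<dots> = (u * u') ^ i * partial_dual v w (u ^ (q - i))"
      unfolding u' by (intro partial_dual_mult_binomial power_closed in_L nz)
    finally have "u ^ (q - i) * partial_dual v w (u' ^ i) = u' ^ i * partial_dual v w (u ^ (q - i))"
      using nz by (simp add: uq power_mult_distrib)
    then show ?thesis using nz by (simp add: field_simps)
  qed
  then have "(\<Sum>i\<in>{1..<q}. ?t u' i) = (\<Sum>i\<in>{1..<q}. ?t u i)"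
    by (intro sum.reindex_bij_witness[of _ "\<lambda>i. q - i" "\<lambda>i. q - i"]) auto
  then show ?thesis using split[of u] split[of u'] last[of u] last[of u'] in_L nz by simp
qed

definition cluster_dual :: "(3 \<Rightarrow> 'f) \<Rightarrow> 'f" where
  "cluster_dual y = dual (y 1) (y 2) (y 3)"

lemma cluster_dual_eq: "cluster_dual y = dual (y l) (y (l + 1)) (y (l + 2))"
  using type_3_cases[of l] dual_rotate[of "y 1" "y 2" "y 3"] dual_rotate[of "y 2" "y 3" "y 1"]
  by (auto simp: cluster_dual_def mod_3_simps(1,2))

lemma cluster_dual_mutate:
  assumes "\<And>i. y i \<in> L" "mutate_cluster a d l y l \<in> L" "\<And>i. y i \<noteq> 0" "mutate_cluster a d l y l \<noteq> 0"
  shows "cluster_dual (mutate_cluster a d l y) = cluster_dual y"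
  unfolding cluster_dual_eq[of _ l]
  using dual_mutate[of "y l" "mutate_cluster a d l y l" "y (l + 1)" "y (l + 2)" "a * d (l + 2)" "a * d (l + 1)"] assms
  by (simp add: mutate_cluster_def exchange_def)

lemma cluster_dual_in_laurent_ring:
  assumes y: "\<And>i. y i \<in> L" and \<theta>: "\<And>f. f \<in> L \<Longrightarrow> \<theta> f \<in> laurent_ring K y"
  shows "cluster_dual y \<in> laurent_ring K y"
proof -
  interpret R: subring_set "laurent_ring K y" by (rule subring_set_laurent_ring)
  show ?thesis
    unfolding cluster_dual_def dual_eq divide_inverse inverse_mult_distrib power_inverse[symmetric]
    by (intro R.sum_closed R.mult_closed R.power_closed \<theta> mult_closed power_closed y laurent_ring_inverse)
qed

end

section \<open>The coefficient of the dual forced by the test element\<close>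

context laurent_frame
begin

text \<open>By additivity a q-th power is taken term by term, which multiplies all exponents by
  q.\<close>

lemma lcoeff_frobenius_power:
  assumes frob: "\<And>f g :: 'f. (f + g) ^ q = f ^ q + g ^ q" and q: "q > 0"
    and f: "f \<in> L" and m: "lcoeff (f ^ q) m \<noteq> 0"
  shows "int q dvd m i"
proof -
  from K nz f have "\<forall>m. lcoeff (f ^ q) m \<noteq> 0 \<longrightarrow> int q dvd m i"
  proof (induction rule: laurent_ring_mon_induct)
    case zero
    then show ?case using q by (simp add: zero_power)
  next
    case (add c n g)
    have "lmonom y n ^ q = lmonom y (\<lambda>i. n i * int q)"
      by (simp only: lmonom_def prod_power_distrib power_int_mult power_int_of_nat)
    then have pow: "(c * lmonom y n + g) ^ q = c ^ q * lmonom y (\<lambda>i. n i * int q) + g ^ q"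
      by (simp add: frob power_mult_distrib)
    have cK: "c ^ q \<in> K" using add.hyps by (intro K.power_closed)
    then have "c ^ q * lmonom y (\<lambda>i. n i * int q) \<in> L"
      by (intro L.mult_closed lmonom_laurent_ring laurent_ring_base)
    moreover have "g ^ q \<in> L" using add.hyps by (intro L.power_closed)
    ultimately have "lcoeff ((c * lmonom y n + g) ^ q) m
        = (if m = (\<lambda>i. n i * int q) then c ^ q else 0) + lcoeff (g ^ q) m" for m
      unfolding pow using cK by (simp add: lcoeff_add lcoeff_mon)
    then show ?case using add.IH by auto
  qed
  with m show ?thesis by blast
qed

end

text \<open>
  Only the term of \<open>cluster_dual\<close> with all three exponents equal to 1 can have the monomial
  $(y_1 y_2 y_3)^{-1}$, because the exponents in a $q$-th power are multiples of $q$.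
\<close>

lemma lcoeff_cluster_dual:
  fixes y :: "3 \<Rightarrow> 'f::field"
  assumes frame: "laurent_frame K y" and ifl: "inverse_frobenius_linear R q \<theta>"
    and yR: "\<And>i. y i \<in> R" and \<theta>: "\<And>f. f \<in> R \<Longrightarrow> \<theta> f \<in> laurent_ring K y"
    and one: "\<theta> (\<Prod>i\<in>UNIV. y i) = 1"
  shows "laurent_frame.lcoeff K y (inverse_frobenius_linear.cluster_dual q \<theta> y) (\<lambda>_. - 1) = 1"
proof -
  interpret laurent_frame K y by fact
  interpret I: inverse_frobenius_linear R q \<theta> by fact
  define s where "s i j k = (\<lambda>l::3. if l = 1 then - int i else if l = 2 then - int j else - int k)" for i j k
  define t where "t i j k = \<theta> (y 1 ^ i * y 2 ^ j * y 3 ^ k)" for i j k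
  have prod: "(\<Prod>i\<in>UNIV. g i) = g 1 * g 2 * g 3" for g :: "3 \<Rightarrow> 'f"
    using prod_3[of g 1] by simp
  have s: "lmonom y (s i j k) = inverse (y 1 ^ i * y 2 ^ j * y 3 ^ k)" for i j k
    by (simp add: lmonom_def prod s_def power_int_minus)
  have tL: "t i j k \<in> L" for i j k
    unfolding t_def by (intro \<theta> I.mult_closed I.power_closed yR)
  have "I.cluster_dual y = (\<Sum>i\<in>{1..q}. \<Sum>j\<in>{1..q}. \<Sum>k\<in>{1..q}. lmonom y (s i j k) * t i j k ^ q)"
    unfolding I.cluster_dual_def I.dual_eq s t_def by (simp add: divide_inverse mult.commute)
  moreover have summand: "lmonom y (s i j k) * t i j k ^ q \<in> L" for i j k
    by (intro L.mult_closed L.power_closed tL lmonom_laurent_ring)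
  ultimately have "lcoeff (I.cluster_dual y) (\<lambda>_. - 1)
      = (\<Sum>i\<in>{1..q}. \<Sum>j\<in>{1..q}. \<Sum>k\<in>{1..q}. lcoeff (lmonom y (s i j k) * t i j k ^ q) (\<lambda>_. - 1))"
    by (simp only: lcoeff_sum L.sum_closed summand)
  also have "\<dots> = (\<Sum>i\<in>{1..q}. \<Sum>j\<in>{1..q}. \<Sum>k\<in>{1..q}. if k = 1 then if j = 1 then if i = 1 then 1 else 0 else 0 else 0)"
  proof (intro sum.cong HOL.refl)
    fix i j k assume ijk: "i \<in> {1..q}" "j \<in> {1..q}" "k \<in> {1..q}"
    have shift: "lcoeff (lmonom y (s i j k) * t i j k ^ q) (\<lambda>_. - 1)
        = lcoeff (t i j k ^ q) ((\<lambda>_. - 1) - s i j k)"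
      by (intro lcoeff_mult_mon L.power_closed tL)
    show "lcoeff (lmonom y (s i j k) * t i j k ^ q) (\<lambda>_. - 1)
        = (if k = 1 then if j = 1 then if i = 1 then 1 else 0 else 0 else 0)"
    proof (cases "i = 1 \<and> j = 1 \<and> k = 1")
      case True
      then have "t i j k = 1" using one by (simp add: t_def prod)
      moreover have "s i j k = (\<lambda>_. - 1)" using True by (simp add: s_def fun_eq_iff)
      ultimately show ?thesis using True lcoeff_mon[OF K.one_closed, of "\<lambda>_. - 1" "\<lambda>_. - 1"] by simp
    next
      case False
      have "lcoeff (t i j k ^ q) ((\<lambda>_. - 1) - s i j k) = 0"
      proof (rule ccontr)
        assume "lcoeff (t i j k ^ q) ((\<lambda>_. - 1) - s i j k) \<noteq> 0"
        then have "int q dvd ((\<lambda>_. - 1) - s i j k) l" for l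
          by (rule lcoeff_frobenius_power[OF I.frobenius I.q tL])
        from this[of 1] this[of 2] this[of 3]
        have "int q dvd int i - 1" "int q dvd int j - 1" "int q dvd int k - 1"
          by (simp_all add: s_def)
        moreover have "n = 1" if "int q dvd int n - 1" "n \<in> {1..q}" for n
          using zdvd_imp_le[OF that(1)] that(2) by force
        ultimately show False using False ijk by blast
      qed
      with False show ?thesis unfolding shift by auto
    qed
  qed
  also have "\<dots> = 1" using I.q by simp
  finally show ?thesis .
qed

theorem proposition5p4:
  fixes K :: "'f::field set" and x :: "3 \<Rightarrow> 'f" and p a :: nat
  assumes "subfield K ring_of_type_algebra"
    and "CHAR('f) = p" and "p > 0"
    and "F_finite K"
    and "a \<ge> 3"
    and "is_cluster K x"
  shows "\<not> strongly_F_regular (upper_cluster_algebra K (cyclic_seed a x))"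
proof
  define U where "U = upper_cluster_algebra K (cyclic_seed a x)"
  assume regular: "strongly_F_regular (upper_cluster_algebra K (cyclic_seed a x))"
  have frame: "laurent_frame K x"
    using assms(1,6) by (intro alg_independent_imp_laurent_frame subfield_subring_set)
      (auto simp: is_cluster_def)
  note nz = laurent_frame.nz[OF frame]
  have U: "U = upper_bound K a (\<lambda>_. 1) x"
    unfolding U_def using upper_bound_subset_upper_cluster_algebra[OF frame assms(5)]
      upper_cluster_algebra_subset_upper_bound by blast
  interpret U: subring_set U
    unfolding U_def upper_cluster_algebra_def
    by (intro subring_set_Inter) (auto intro: subring_set_laurent_ring)
  have x: "x i \<in> U" "mutate_cluster a (\<lambda>_. 1) i x i \<in> U" for i
    unfolding U using cluster_variables_in_upper_bound[OF frame] assms(5) by simp_all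
  let ?g = "\<Prod>i\<in>UNIV. x i"
  have "?g \<in> U" "?g \<noteq> 0" using x nz by (auto intro: U.prod_closed)
  then obtain e \<psi> y where \<psi>: "frobenius_hom e U \<psi>" "y ^ (CHAR('f) ^ e) = to_ac ?g" "\<psi> y = 1"
    using regular unfolding strongly_F_regular_def U_def by blast
  define q where "q = CHAR('f) ^ e"
  have pos: "CHAR('f) > 0" using assms(2,3) by simp
  obtain \<theta> where \<theta>: "\<And>f. f \<in> U \<Longrightarrow> \<theta> f \<in> U" "\<And>f g. f \<in> U \<Longrightarrow> g \<in> U \<Longrightarrow> \<theta> (f + g) = \<theta> f + \<theta> g"
      "\<And>r f. r \<in> U \<Longrightarrow> f \<in> U \<Longrightarrow> \<theta> (r ^ q * f) = r * \<theta> f"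
      and "\<And>f y. y ^ q = to_ac f \<Longrightarrow> \<theta> f = \<psi> y"
    using frobenius_hom_imp_inverse_linear[OF \<psi>(1) pos, folded q_def] by blast
  then have one: "\<theta> ?g = 1" using \<psi>(2,3) by (simp add: q_def)
  have "prime CHAR('f)" using pos by (rule prime_CHAR_semidom)
  then interpret I: inverse_frobenius_linear U q \<theta>
    using \<theta> pos freshmans_dream'[where ?'a = 'f and m = q and n = e]
    by unfold_locales (auto simp: q_def)
  define h where "h = I.cluster_dual x"
  have UL: "f \<in> laurent_ring K x" "f \<in> laurent_ring K (mutate_cluster a (\<lambda>_. 1) l x)" if "f \<in> U" for f l
    using that by (auto simp: U upper_bound_def)
  have hx: "h \<in> laurent_ring K x"
    unfolding h_def by (intro I.cluster_dual_in_laurent_ring x UL \<theta>)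
  have "h \<in> laurent_ring K (mutate_cluster a (\<lambda>_. 1) l x)" for l
  proof -
    have "laurent_frame K (mutate_cluster a (\<lambda>_. 1) l x)"
      using assms(5) by (intro laurent_frame_mutate_cluster[OF frame]) auto
    note nz' = laurent_frame.nz[OF this]
    \<comment> \<open>Written in the neighbouring cluster, the same element has only monomials of
      that cluster as denominators, and its numerators are q-th powers of elements of
      \<open>U\<close>.\<close>
    have "h = I.cluster_dual (mutate_cluster a (\<lambda>_. 1) l x)"
      unfolding h_def by (intro I.cluster_dual_mutate[symmetric] x nz nz')
    also have "mutate_cluster a (\<lambda>_. 1) l x i \<in> U" for i
      using x by (cases "i = l") (simp_all add: mutate_cluster_def)
    then have "I.cluster_dual (mutate_cluster a (\<lambda>_. 1) l x) \<in> laurent_ring K (mutate_cluster a (\<lambda>_. 1) l x)"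
      by (intro I.cluster_dual_in_laurent_ring UL \<theta>)
    finally show ?thesis .
  qed
  then have "h \<in> laurent_ring K (x(l := exchange a (\<lambda>_. 1) x l / x l))" for l
    by (simp add: mutate_cluster_def)
  moreover have "laurent_frame.lcoeff K x h (\<lambda>_. - 1) \<noteq> 0"
    unfolding h_def using lcoeff_cluster_dual[OF frame I.inverse_frobenius_linear_axioms x(1) UL(1)[OF \<theta>(1)] one]
    by simp
  ultimately have "sum (\<lambda>_. - 1 :: int) (UNIV :: 3 set) \<ge> 0"
    by (rule degree_nonneg[OF frame assms(5) hx])
  then show False by simp
qed

end
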